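(* Assume $r\ge d/2$. Suppose that $f$ satisfies $f_u\le 0$ with $f_u$ and $f_{uu}$ bounded, that the problem $-\Delta u=f(x,u)$ in $\Omega$, $u=0$ on $\partial\Omega$, has a solution $u\in H_0^1(\Omega)\cap H^{r+1}(\Omega)$, and that the penalty parameter $\lambda$ is sufficiently large. Then, when $h$ is small enough, the discrete variational problem: find $u_h\in V_h$ such that $$a_h(u_h,v_h)=(f(u_h),v_h)\qquad\forall\, v_h\in V_h,$$ has a unique solution $u_h\in V_h$.
   Context: Setting. $\Omega\subset\mathbb{R}^d$ ($d=2,3$) is a bounded polygonal (polyhedral) domain. The nonlinearity $f=f(x,s)$ is abbreviated $f(u)=f(x,u(x))$; $f_u,f_{uu}$ denote first and second derivatives in the second argument, which exist ($f$ is assumed measurable in $x$ and twice continuously differentiable in $s$). $f_u\le 0$ and boundedness of $f_u$, $f_{uu}$ are understood over all arguments. $\{\mathcal{T}_h\}$ is a quasi-uniform family of conforming partitions (no hanging nodes) of $\Omega$ into $d$-simplices $K$, $h_K$ is the diameter of $K$, $h=\max_K h_K$. For an integer $r\ge1$, $$V_h=\{v_h\in L^2(\Omega): v_h|_K\in\mathcal{P}_r(K)\ \forall K\in\mathcal{T}_h,\ v_h|_{\partial\Omega}=0\},$$ where $\mathcal{P}_r(K)$ is the set of polynomials of degree at most $r$ on $K$. $\mathcal{E}_h$ is the set of all edges ($d=2$) or faces ($d=3$), and $h_e$ is the diameter of $e\in\mathcal{E}_h$. On an interior $e$ shared by $K_+,K_-$, with $\boldsymbol n_\pm$ the unit normal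 of $e$ pointing out of $K_\pm$: $[v]=v_+\boldsymbol n_++v_-\boldsymbol n_-$, $\{\boldsymbol w\}=\frac12(\boldsymbol w_++\boldsymbol w_-)$. On a boundary $e$ with outward unit normal $\boldsymbol n$: $[v]=v\boldsymbol n$, $\{\boldsymbol w\}=\boldsymbol w$. The bilinear form is $$a_h(w,v)=\sum_{K}(\nabla w,\nabla v)_K-\sum_{e\in\mathcal{E}_h}\int_e\{\nabla w\}\cdot[v]\,ds-\sum_{e\in\mathcal{E}_h}\int_e\{\nabla v\}\cdot[w]\,ds+\sum_{e\in\mathcal{E}_h}\int_e\frac{\lambda}{h_e}[w]\cdot[v]\,ds,$$ and $(\cdot,\cdot)$ is the $L^2(\Omega)$ inner product. The DG norm is $$|\|w\||_h=\Big(\sum_K\|\nabla w\|_{0,K}^2+\sum_{e\in\mathcal{E}_h}\frac{h_e}{\lambda}\|\{\nabla w\}\|_{0,e}^2+\sum_{e\in\mathcal{E}_h}\frac{\lambda}{h_e}\|[w]\|_{0,e}^2\Big)^{1/2}.$$ "$\lambda$ sufficiently large" means that the fixed constant $\lambda>0$ (independent of $h$) is large enough that $\frac14|\|v_h\||_h^2\le a_h(v_h,v_h)$ for all $v_h\in V_h$ and all $h$. "$h$ small enough" means there is $h_0>0$ such that the conclusion holds for all $h\le h_0$. *)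

theory Defs
  imports "HOL-Analysis.Analysis"
begin

section \<open>Function spaces on a domain\<close>

text \<open>Elements of \<open>L\<^sup>2(\<Omega>)\<close> are represented by functions; identity in \<open>L\<^sup>2(\<Omega>)\<close> is equality
  almost everywhere on \<open>\<Omega>\<close>.\<close>

definition L2 :: "(real^'d) set \<Rightarrow> (real^'d \<Rightarrow> real) set" where
  "L2 \<Omega> = {v. v \<in> borel_measurable (lebesgue_on \<Omega>) \<and> integrable (lebesgue_on \<Omega>) (\<lambda>x. (v x)\<^sup>2)}"

definition partial :: "'d \<Rightarrow> (real^'d \<Rightarrow> real) \<Rightarrow> real^'d \<Rightarrow> real" where
  "partial i \<phi> = (\<lambda>x. frechet_derivative \<phi> (at x) (axis i 1))"

text \<open>A multi-index of order \<open>k\<close> is given by a list of \<open>k\<close> coordinate directions.\<close>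

abbreviation partials :: "'d list \<Rightarrow> (real^'d \<Rightarrow> real) \<Rightarrow> real^'d \<Rightarrow> real" where
  "partials js \<phi> \<equiv> foldr partial js \<phi>"

definition test_functions :: "(real^'d) set \<Rightarrow> (real^'d \<Rightarrow> real) set" where
  "test_functions \<Omega> = {\<phi>. (\<forall>js. partials js \<phi> differentiable_on UNIV) \<and>
     (\<exists>C. compact C \<and> C \<subseteq> \<Omega> \<and> (\<forall>x. x \<notin> C \<longrightarrow> \<phi> x = 0))}"

definition weak_partials ::
  "(real^'d) set \<Rightarrow> 'd list \<Rightarrow> (real^'d \<Rightarrow> real) \<Rightarrow> (real^'d \<Rightarrow> real) \<Rightarrow> bool" where
  "weak_partials \<Omega> js v g \<longleftrightarrow> (\<forall>\<phi>\<in>test_functions \<Omega>.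
     (LINT x|lebesgue_on \<Omega>. v x * partials js \<phi> x)
       = (-1) ^ length js * (LINT x|lebesgue_on \<Omega>. g x * \<phi> x))"

definition sobolev :: "nat \<Rightarrow> (real^'d) set \<Rightarrow> (real^'d \<Rightarrow> real) set" where
  "sobolev k \<Omega> = {v \<in> L2 \<Omega>. \<forall>js. length js \<le> k \<longrightarrow> (\<exists>g\<in>L2 \<Omega>. weak_partials \<Omega> js v g)}"

text \<open>\<open>H\<^sup>1\<^sub>0(\<Omega>)\<close>: the closure of the test functions in the \<open>H\<^sup>1\<close> norm.\<close>

definition sobolev_1_0 :: "(real^'d) set \<Rightarrow> (real^'d \<Rightarrow> real) set" where
  "sobolev_1_0 \<Omega> = {v \<in> sobolev 1 \<Omega>. \<exists>\<phi> g. (\<forall>n::nat. \<phi> n \<in> test_functions \<Omega>) \<and>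
     (\<lambda>n. LINT x|lebesgue_on \<Omega>. (v x - \<phi> n x)\<^sup>2) \<longlonglongrightarrow> 0 \<and>
     (\<forall>i. g i \<in> L2 \<Omega> \<and> weak_partials \<Omega> [i] v (g i) \<and>
        (\<lambda>n. LINT x|lebesgue_on \<Omega>. (g i x - partial i (\<phi> n) x)\<^sup>2) \<longlonglongrightarrow> 0)}"

text \<open>\<open>-\<Delta>u = f(x,u)\<close> in \<open>\<Omega>\<close> for \<open>u \<in> H\<^sup>2(\<Omega>)\<close>, with weak second derivatives.  The homogeneous
  Dirichlet condition is not part of this predicate but is membership in \<open>H\<^sup>1\<^sub>0(\<Omega>)\<close>.\<close>

definition solves_semilinear ::
  "(real^'d) set \<Rightarrow> (real^'d \<Rightarrow> real \<Rightarrow> real) \<Rightarrow> (real^'d \<Rightarrow> real) \<Rightarrow> bool" where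
  "solves_semilinear \<Omega> f u \<longleftrightarrow> (\<exists>g. (\<forall>i. g i \<in> L2 \<Omega> \<and> weak_partials \<Omega> [i, i] u (g i)) \<and>
     (AE x in lebesgue_on \<Omega>. - (\<Sum>i\<in>UNIV. g i x) = f x (u x)))"


section \<open>Domains and meshes\<close>

text \<open>\<open>interior (closure \<Omega>) = \<Omega>\<close> excludes slits and isolated punctures.\<close>

definition polyhedral_domain :: "(real^'d) set \<Rightarrow> bool" where
  "polyhedral_domain \<Omega> \<longleftrightarrow> open \<Omega> \<and> connected \<Omega> \<and> bounded \<Omega> \<and> \<Omega> \<noteq> {} \<and>
     interior (closure \<Omega>) = \<Omega> \<and> (\<exists>\<P>. finite \<P> \<and> (\<forall>P\<in>\<P>. polytope P) \<and> closure \<Omega> = \<Union>\<P>)"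

text \<open>The library's \<^const>\<open>triangulation\<close> includes conformity: any two members intersect in a
  (possibly empty) common face, so there are no hanging nodes.\<close>

definition conforming_mesh :: "(real^'d) set \<Rightarrow> (real^'d) set set \<Rightarrow> bool" where
  "conforming_mesh \<Omega> \<T> \<longleftrightarrow> triangulation \<T> \<and> (\<forall>K\<in>\<T>. int CARD('d) simplex K) \<and> \<Union>\<T> = closure \<Omega>"

definition mesh_size :: "(real^'d) set set \<Rightarrow> real" where
  "mesh_size \<T> = Max (diameter ` \<T>)"

text \<open>Every element contains a ball of radius comparable to the global mesh size, uniformly in
  the family; this comprises shape regularity.\<close>

definition quasi_uniform :: "(real^'d) set set set \<Rightarrow> bool" where
  "quasi_uniform \<TT> \<longleftrightarrow> (\<exists>c>0. \<forall>\<T>\<in>\<TT>. \<forall>K\<in>\<T>. \<exists>x. cball x (c * mesh_size \<T>) \<subseteq> K)"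

definition mesh_faces :: "(real^'d) set set \<Rightarrow> (real^'d) set set" where
  "mesh_faces \<T> = {e. \<exists>K\<in>\<T>. e facet_of K}"

text \<open>The elements adjacent to a face: two for an interior face, one for a boundary face.\<close>

definition adjacent :: "(real^'d) set set \<Rightarrow> (real^'d) set \<Rightarrow> (real^'d) set set" where
  "adjacent \<T> e = {K\<in>\<T>. e facet_of K}"

definition outward_normal :: "(real^'d) set \<Rightarrow> (real^'d) set \<Rightarrow> real^'d" where
  "outward_normal K e =
     (THE n. norm n = 1 \<and> (\<exists>b. e \<subseteq> {x. n \<bullet> x = b} \<and> K \<subseteq> {x. n \<bullet> x \<le> b}))"

text \<open>The \<open>(d-1)\<close>-dimensional surface measure on a flat face \<open>e\<close>: with \<open>n\<close> a unit normal of \<open>e\<close>,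
  the image of \<open>d\<close>-dimensional Lebesgue measure on the right prism \<open>e + [0,1] n\<close> of height one
  under orthogonal projection onto \<open>e\<close>.  By Fubini this is Lebesgue measure on the hyperplane
  through \<open>e\<close>, restricted to \<open>e\<close>; the sign of \<open>n\<close> is immaterial.\<close>

definition surface_measure :: "(real^'d) set \<Rightarrow> (real^'d) measure" where
  "surface_measure e =
    (let n = (SOME n. norm n = 1 \<and> (\<forall>x\<in>e. \<forall>y\<in>e. n \<bullet> (x - y) = 0))
     in distr (lebesgue_on {y + t *\<^sub>R n | y t. y \<in> e \<and> 0 \<le> t \<and> t \<le> 1}) borel (closest_point e))"


section \<open>The discontinuous Galerkin discretization\<close>

definition polys :: "nat \<Rightarrow> (real^'d \<Rightarrow> real) set" where
  "polys r = {p. \<exists>c :: ('d \<Rightarrow> nat) \<Rightarrow> real. \<forall>x.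
     p x = (\<Sum>\<alpha> | (\<Sum>i\<in>UNIV. \<alpha> i) \<le> r. c \<alpha> * (\<Prod>i\<in>UNIV. (x $ i) ^ \<alpha> i))}"

text \<open>The polynomial that represents \<open>v\<close> on the element \<open>K\<close>.  Its values on \<open>\<partial>K\<close> are the one-sided
  traces of \<open>v\<close> from \<open>K\<close>.\<close>

definition piece :: "(real^'d \<Rightarrow> real) \<Rightarrow> (real^'d) set \<Rightarrow> real^'d \<Rightarrow> real" where
  "piece v K = (THE p. real_polynomial_function p \<and> (AE x in lebesgue_on K. v x = p x))"

definition gradient :: "(real^'d \<Rightarrow> real) \<Rightarrow> real^'d \<Rightarrow> real^'d" where
  "gradient p x = (\<chi> i. partial i p x)"

definition DG_space :: "(real^'d) set \<Rightarrow> (real^'d) set set \<Rightarrow> nat \<Rightarrow> (real^'d \<Rightarrow> real) set" where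
  "DG_space \<Omega> \<T> r = {v \<in> L2 \<Omega>.
     (\<forall>K\<in>\<T>. \<exists>p\<in>polys r. AE x in lebesgue_on K. v x = p x) \<and>
     (\<forall>e\<in>mesh_faces \<T>. e \<subseteq> frontier \<Omega> \<longrightarrow> (\<forall>K\<in>adjacent \<T> e. \<forall>x\<in>e. piece v K x = 0))}"

text \<open>Summing over the adjacent elements covers interior and boundary faces at once: the sums have
  two terms on an interior face and one term on a boundary face.\<close>

definition jump :: "(real^'d) set set \<Rightarrow> (real^'d) set \<Rightarrow> (real^'d \<Rightarrow> real) \<Rightarrow> real^'d \<Rightarrow> real^'d" where
  "jump \<T> e v x = (\<Sum>K\<in>adjacent \<T> e. piece v K x *\<^sub>R outward_normal K e)"

definition avg_gradient ::
  "(real^'d) set set \<Rightarrow> (real^'d) set \<Rightarrow> (real^'d \<Rightarrow> real) \<Rightarrow> real^'d \<Rightarrow> real^'d" where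
  "avg_gradient \<T> e w x =
     (1 / real (card (adjacent \<T> e))) *\<^sub>R (\<Sum>K\<in>adjacent \<T> e. gradient (piece w K) x)"

definition DG_form ::
  "(real^'d) set set \<Rightarrow> real \<Rightarrow> (real^'d \<Rightarrow> real) \<Rightarrow> (real^'d \<Rightarrow> real) \<Rightarrow> real" where
  "DG_form \<T> lam w v =
     (\<Sum>K\<in>\<T>. LINT x|lebesgue_on K. gradient (piece w K) x \<bullet> gradient (piece v K) x)
     - (\<Sum>e\<in>mesh_faces \<T>. LINT x|surface_measure e. avg_gradient \<T> e w x \<bullet> jump \<T> e v x)
     - (\<Sum>e\<in>mesh_faces \<T>. LINT x|surface_measure e. avg_gradient \<T> e v x \<bullet> jump \<T> e w x)
     + (\<Sum>e\<in>mesh_faces \<T>. LINT x|surface_measure e.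
          (lam / diameter e) * (jump \<T> e w x \<bullet> jump \<T> e v x))"

definition DG_norm :: "(real^'d) set set \<Rightarrow> real \<Rightarrow> (real^'d \<Rightarrow> real) \<Rightarrow> real" where
  "DG_norm \<T> lam w = sqrt (
     (\<Sum>K\<in>\<T>. LINT x|lebesgue_on K. (norm (gradient (piece w K) x))\<^sup>2)
     + (\<Sum>e\<in>mesh_faces \<T>. (diameter e / lam) *
          (LINT x|surface_measure e. (norm (avg_gradient \<T> e w x))\<^sup>2))
     + (\<Sum>e\<in>mesh_faces \<T>. (lam / diameter e) *
          (LINT x|surface_measure e. (norm (jump \<T> e w x))\<^sup>2)))"

definition solves_DG ::
  "(real^'d) set \<Rightarrow> (real^'d) set set \<Rightarrow> nat \<Rightarrow> real \<Rightarrow> (real^'d \<Rightarrow> real \<Rightarrow> real)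
     \<Rightarrow> (real^'d \<Rightarrow> real) \<Rightarrow> bool" where
  "solves_DG \<Omega> \<T> r lam f uh \<longleftrightarrow> uh \<in> DG_space \<Omega> \<T> r \<and>
     (\<forall>vh\<in>DG_space \<Omega> \<T> r. DG_form \<T> lam uh vh = (LINT x|lebesgue_on \<Omega>. f x (uh x) * vh x))"

end

(*  The DG form is symmetric and, by the coercivity assumption, positive semidefinite on the discrete
    space. Its kernel is trivial: vanishing DG norm makes a function constant on every element with
    vanishing jumps, also across boundary faces, and such a function is zero. Hence the space has a
    finite orthonormal basis for the form. Since f(x, .) is nonincreasing and Lipschitz, in
    coordinates the problem is x = G x with -G monotone and G Lipschitz, and the damped map
    x - t (x - G x) is a contraction for small t > 0. Uniqueness follows by testing the difference of
    two solutions with itself. None of this restricts h, so any h0 will do; the solution u serves only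
    to show that f(x, v) is square integrable whenever v is. *)

theory Submission
  imports Defs
begin

text \<open>Elements of \<open>DG_space\<close> are functions rather than classes, so the form is
  only semidefinite on the space: functions that vanish almost everywhere lie in its kernel. The
  abstract argument therefore works modulo the kernel. There an orthonormal family counts as
  complete once every residual has form zero, and the right-hand side must vanish on the kernel as
  well. Finite dimension enters only as a bound on the length of orthonormal families.

  The geometric obstacle is the passage from constants without jumps to zero. A jump compares only
  elements that share a whole facet, whereas elements may also meet in a vertex or an edge. Hence
  all elements with one common nonzero value are treated at once, and the argument rests on the
  boundedness of their union.

  Square integrability starts from \<open>f x (u x)\<close>, which is minus a sum of weak second
  derivatives in \<open>L2\<close>; the Lipschitz bound carries it over to every other function in
  \<open>L2\<close>.\<close>

section \<open>Polynomials\<close>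

text \<open>Inside \<open>K\<close> the set where \<open>p\<close> is nonzero is open and
  negligible, hence empty. On the line from an interior point to \<open>y\<close> the polynomial has
  one variable and infinitely many zeros, so all its coefficients vanish, and parameter 1 gives the
  value at \<open>y\<close>.\<close>

lemma real_polynomial_function_zero_if_AE:
  fixes p :: "real^'d \<Rightarrow> real"
  assumes p: "real_polynomial_function p" and K: "interior K \<noteq> {}" "K \<in> sets lebesgue"
    and ae: "AE x in lebesgue_on K. p x = 0"
  shows "p y = 0"
proof -
  have cont: "continuous_on UNIV p"
    using p by (simp add: differentiable_imp_continuous_on differentiable_on_real_polynomial_function)
  let ?U = "interior K \<inter> {x. p x \<noteq> 0}"
  have "open ?U"
    using cont by (intro open_Int open_interior open_Collect_neq continuous_on_const)
  then have Um: "?U \<in> sets lebesgue" by (auto intro: borel_open)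
  have "AE x in lebesgue. x \<in> K \<longrightarrow> p x = 0"
    using ae K by (simp add: AE_restrict_space_iff)
  then have "AE x in lebesgue. x \<notin> ?U"
    by eventually_elim (use interior_subset in auto)
  then have "negligible ?U"
    using AE_iff_null_sets[OF Um] negligible_iff_null_sets by blast
  then have U: "?U = {}"
    using \<open>open ?U\<close> open_not_negligible by blast
  obtain z e where z: "e > 0" "ball z e \<subseteq> interior K"
    using K by (meson ex_in_conv open_contains_ball open_interior)
  let ?q = "\<lambda>t::real. p (z + t *\<^sub>R (y - z))"
  have "polynomial_function (\<lambda>t::real. z + t *\<^sub>R (y - z))"
    by (intro polynomial_function_add polynomial_function_const
        polynomial_function_mult polynomial_function_id)
  then have "real_polynomial_function ?q"
    using real_polynomial_function_compose[OF _ p] by (simp add: o_def)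
  then obtain a n where a: "?q = (\<lambda>t. \<Sum>i\<le>n. a i * t ^ i)"
    by (auto simp: real_polynomial_function_iff_sum)
  \<comment> \<open>For parameters below \<open>\<delta>\<close> the line is still in the ball of
    radius \<open>e\<close>; the summand 1 covers the case \<open>y = z\<close>.\<close>
  define \<delta> where "\<delta> = e / (norm (y - z) + 1)"
  have pos: "norm (y - z) + 1 > 0"
    using norm_ge_zero[of "y - z"] by linarith
  have \<delta>: "\<delta> > 0"
    using z pos by (simp add: \<delta>_def)
  have "?q t = 0" if "t \<in> {0<..<\<delta>}" for t
  proof -
    have "norm (t *\<^sub>R (y - z)) \<le> t * (norm (y - z) + 1)"
      using that by (simp add: mult_left_mono)
    also have "\<dots> < \<delta> * (norm (y - z) + 1)"
      using that pos by (intro mult_strict_right_mono) auto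
    also have "\<dots> = e"
      using pos by (simp add: \<delta>_def)
    finally have "z + t *\<^sub>R (y - z) \<in> ball z e"
      by (simp add: dist_norm)
    then have "z + t *\<^sub>R (y - z) \<in> interior K" using z(2) by (rule subsetD[rotated])
    then show ?thesis using U by blast
  qed
  then have "{0<..<\<delta>} \<subseteq> {t. (\<Sum>i\<le>n. a i * t ^ i) = 0}"
    using fun_cong[OF a] by auto
  moreover have "infinite {0<..<\<delta>}"
    using \<delta> by simp
  ultimately have "infinite {t. (\<Sum>i\<le>n. a i * t ^ i) = 0}"
    using finite_subset by blast
  then have "\<forall>i\<le>n. a i = 0"
    using polyfun_finite_roots[of a n] by auto
  then have "?q 1 = 0"
    using fun_cong[OF a, of 1] by simp
  then show ?thesis by simp
qed

lemma partial_eqI: "(\<phi> has_derivative D) (at x) \<Longrightarrow> partial i \<phi> x = D (axis i 1)"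
  by (simp add: partial_def frechet_derivative_at[symmetric])

lemma partial_add:
  assumes "\<phi> differentiable (at x)" "\<psi> differentiable (at x)"
  shows "partial i (\<lambda>x. \<phi> x + \<psi> x) x = partial i \<phi> x + partial i \<psi> x"
  using assms[unfolded frechet_derivative_works]
  by (subst partial_eqI[OF has_derivative_add]) (auto simp: partial_def)

lemma partial_mult:
  assumes "\<phi> differentiable (at x)" "\<psi> differentiable (at x)"
  shows "partial i (\<lambda>x. \<phi> x * \<psi> x) x = \<phi> x * partial i \<psi> x + partial i \<phi> x * \<psi> x"
  using assms[unfolded frechet_derivative_works]
  by (subst partial_eqI[OF has_derivative_mult]) (auto simp: partial_def)

lemma partial_const [simp]: "partial i (\<lambda>x. c) = (\<lambda>x. 0)"
  by (rule ext) (simp add: partial_eqI[OF has_derivative_const])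

lemma partial_linear_combination:
  assumes "\<phi> differentiable (at x)" "\<psi> differentiable (at x)"
  shows "partial i (\<lambda>x. a * \<phi> x + b * \<psi> x) x = a * partial i \<phi> x + b * partial i \<psi> x"
  using assms by (simp add: partial_add partial_mult)

lemma real_polynomial_function_partial:
  assumes "real_polynomial_function p"
  shows "real_polynomial_function (partial i p)"
  using assms
proof induction
  case (linear f)
  have "partial i f = (\<lambda>x. f (axis i 1))"
    using linear by (auto intro!: partial_eqI bounded_linear_imp_has_derivative)
  then show ?case by auto
next
  case (const c)
  then show ?case by auto
next
  case (add f g)
  then have "partial i (\<lambda>x. f x + g x) = (\<lambda>x. partial i f x + partial i g x)"
    by (intro ext partial_add differentiable_at_real_polynomial_function)
  with add show ?case by auto
next
  case (mult f g)
  then have "partial i (\<lambda>x. f x * g x) = (\<lambda>x. f x * partial i g x + partial i f x * g x)"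
    by (intro ext partial_mult differentiable_at_real_polynomial_function)
  with mult show ?case by auto
qed

lemma continuous_on_gradient:
  assumes "real_polynomial_function p"
  shows "continuous_on S (gradient p)"
  unfolding gradient_def
  using real_polynomial_function_partial[OF assms]
  by (intro continuous_on_vec_lambda)
    (simp add: differentiable_imp_continuous_on differentiable_on_real_polynomial_function)

lemma gradient_linear_combination:
  assumes "real_polynomial_function p" "real_polynomial_function q"
  shows "gradient (\<lambda>x. a * p x + b * q x) x = a *\<^sub>R gradient p x + b *\<^sub>R gradient q x"
  using assms by (simp add: gradient_def vec_eq_iff partial_linear_combination
      differentiable_at_real_polynomial_function)

text \<open>A sum over an infinite index set is 0 by default, so finiteness is what makes the sums
  in \<open>polys\<close> genuine.\<close>

lemma finite_multi_indices: "finite {\<alpha> :: 'd::finite \<Rightarrow> nat. (\<Sum>i\<in>UNIV. \<alpha> i) \<le> r}"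
proof (rule finite_subset)
  show "{\<alpha> :: 'd \<Rightarrow> nat. (\<Sum>i\<in>UNIV. \<alpha> i) \<le> r} \<subseteq> PiE UNIV (\<lambda>_. {..r})"
  proof
    fix \<alpha> :: "'d \<Rightarrow> nat" assume "\<alpha> \<in> {\<alpha>. (\<Sum>i\<in>UNIV. \<alpha> i) \<le> r}"
    then have "\<alpha> j \<le> r" for j
      using member_le_sum[of j UNIV \<alpha>] by simp
    then show "\<alpha> \<in> PiE UNIV (\<lambda>_. {..r})" by auto
  qed
qed (rule finite_PiE, simp_all)

lemma polys_real_polynomial_function:
  assumes "p \<in> polys r" shows "real_polynomial_function p"
proof -
  obtain c :: "('a \<Rightarrow> nat) \<Rightarrow> real" where
    c: "p = (\<lambda>x. \<Sum>\<alpha> | (\<Sum>i\<in>UNIV. \<alpha> i) \<le> r. c \<alpha> * (\<Prod>i\<in>UNIV. (x $ i) ^ \<alpha> i))"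
    using assms unfolding polys_def fun_eq_iff by blast
  have "real_polynomial_function (\<lambda>x. c \<alpha> * (\<Prod>i\<in>UNIV. (x $ i) ^ \<alpha> i))" for \<alpha>
  proof (rule real_polynomial_function.intros(4)[OF real_polynomial_function.intros(2)])
    have "real_polynomial_function (\<lambda>x::real^'a. (x $ i) ^ \<alpha> i)" for i
      by (rule real_polynomial_function_power[OF real_polynomial_function.intros(1)[OF bounded_linear_vec_nth]])
    then show "real_polynomial_function (\<lambda>x::real^'a. \<Prod>i\<in>UNIV. (x $ i) ^ \<alpha> i)"
      by (intro real_polynomial_function_prod) auto
  qed
  then show ?thesis
    unfolding c by (rule real_polynomial_function_sum[OF finite_multi_indices])
qed

lemma polys_linear_combination:
  assumes "p \<in> polys r" "q \<in> polys r"
  shows "(\<lambda>x. a * p x + b * q x) \<in> polys r"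
proof -
  obtain c d where
    c: "\<And>x. p x = (\<Sum>\<alpha> | (\<Sum>i\<in>UNIV. \<alpha> i) \<le> r. c \<alpha> * (\<Prod>i\<in>UNIV. (x $ i) ^ \<alpha> i))" and
    d: "\<And>x. q x = (\<Sum>\<alpha> | (\<Sum>i\<in>UNIV. \<alpha> i) \<le> r. d \<alpha> * (\<Prod>i\<in>UNIV. (x $ i) ^ \<alpha> i))"
    using assms unfolding polys_def by blast
  have "a * p x + b * q x = (\<Sum>\<alpha> | (\<Sum>i\<in>UNIV. \<alpha> i) \<le> r.
      (a * c \<alpha> + b * d \<alpha>) * (\<Prod>i\<in>UNIV. (x $ i) ^ \<alpha> i))" for x
    unfolding c d by (simp add: sum_distrib_left distrib_right sum.distrib mult.assoc)
  then show ?thesis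
    unfolding polys_def by (intro CollectI exI allI)
qed

section \<open>Piecewise polynomial functions\<close>

text \<open>Leaves out the degree, square integrability and the boundary condition: the calculus of
  the form only needs each piece to be some polynomial.\<close>

definition piecewise_polynomial :: "(real^'d) set set \<Rightarrow> (real^'d \<Rightarrow> real) \<Rightarrow> bool" where
  "piecewise_polynomial \<T> v \<longleftrightarrow>
     (\<forall>K\<in>\<T>. \<exists>p. real_polynomial_function p \<and> (AE x in lebesgue_on K. v x = p x))"

text \<open>Two polynomials that agree almost everywhere on a set with interior points agree
  everywhere, which makes the description in \<open>piece\<close> unique.\<close>

lemma piece_eqI:
  assumes p: "real_polynomial_function p" and K: "interior K \<noteq> {}" "K \<in> sets lebesgue"
    and ae: "AE x in lebesgue_on K. v x = p x"
  shows "piece v K = p"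
  unfolding piece_def
proof (rule the_equality)
  fix q assume q: "real_polynomial_function q \<and> (AE x in lebesgue_on K. v x = q x)"
  then have "AE x in lebesgue_on K. q x - p x = 0"
  proof -
    have "AE x in lebesgue_on K. v x = q x" using q by blast
    with ae show ?thesis by eventually_elim simp
  qed
  then have "q y - p y = 0" for y
    using q p K real_polynomial_function_zero_if_AE[of "\<lambda>x. q x - p x" K y] by auto
  then show "q = p" by (auto simp: fun_eq_iff)
qed (use p ae in auto)

lemma gradient_zero_if_AE:
  assumes p: "real_polynomial_function p" and K: "interior K \<noteq> {}" "K \<in> sets lebesgue"
    and ae: "AE x in lebesgue_on K. gradient p x = 0"
  shows "p x = p y"
proof -
  have d0: "gradient p z = 0" for z
  proof -
    have "partial i p z = 0" for i
    proof (rule real_polynomial_function_zero_if_AE[OF real_polynomial_function_partial[OF p] K])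
      show "AE x in lebesgue_on K. partial i p x = 0"
        using ae by eventually_elim (simp add: gradient_def vec_eq_iff)
    qed
    then show ?thesis by (simp add: gradient_def vec_eq_iff)
  qed
  have "(p has_derivative (\<lambda>h. 0)) (at z)" for z
  proof -
    let ?D = "frechet_derivative p (at z)"
    have D: "(p has_derivative ?D) (at z)"
      using p differentiable_at_real_polynomial_function frechet_derivative_works by blast
    have lin: "linear ?D"
      using D has_derivative_linear by blast
    have "?D h = 0" for h
    proof -
      \<comment> \<open>A linear map is determined by its values on the coordinate directions, which
        are the partial derivatives.\<close>
      have "?D (\<Sum>i\<in>UNIV. (h $ i) *\<^sub>R axis i 1) = (\<Sum>i\<in>UNIV. (h $ i) * partial i p z)"
        using lin by (simp add: linear_sum linear_cmul partial_def)
      also have "(\<Sum>i\<in>UNIV. (h $ i) *\<^sub>R axis i (1::real)) = h"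
        by (simp add: basis_expansion flip: scalar_mult_eq_scaleR)
      finally show ?thesis
        using d0[of z] by (simp add: gradient_def vec_eq_iff)
    qed
    then have "?D = (\<lambda>h. 0)" by auto
    with D show ?thesis by simp
  qed
  then obtain c where "\<And>x. x \<in> UNIV \<Longrightarrow> p x = c"
    using has_derivative_zero_constant[of UNIV p] by auto
  then show ?thesis by simp
qed

section \<open>Elements and facets\<close>

text \<open>One affine set contains the other and both have the same dimension.\<close>

lemma affine_hull_facet:
  fixes n :: "'a::euclidean_space"
  assumes "e \<noteq> {}" "aff_dim e = int DIM('a) - 1" "norm n = 1" "e \<subseteq> {x. n \<bullet> x = b}"
  shows "affine hull e = {x. n \<bullet> x = b}"
proof (rule affine_dim_equal)
  have "n \<noteq> 0" using assms by auto
  then show "aff_dim (affine hull e) = aff_dim {x. n \<bullet> x = b}"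
    using assms by (simp add: aff_dim_affine_hull)
  show "affine hull e \<subseteq> {x. n \<bullet> x = b}"
    using assms by (intro hull_minimal affine_hyperplane)
qed (use assms in \<open>auto simp: affine_hyperplane\<close>)

text \<open>Every direction orthogonal to \<open>n\<close> runs inside the affine hull of
  \<open>e\<close> and is therefore orthogonal to \<open>n'\<close> too. So \<open>n'\<close> is
  parallel to \<open>n\<close>, and unit length leaves only the sign open.\<close>

lemma hyperplane_unit_normal_unique:
  fixes n n' :: "'a::euclidean_space"
  assumes e: "e \<noteq> {}" "aff_dim e = int DIM('a) - 1"
    and n: "norm n = 1" "e \<subseteq> {x. n \<bullet> x = b}" and n': "norm n' = 1" "e \<subseteq> {x. n' \<bullet> x = b'}"
  shows "n' = n \<or> n' = - n"
proof -
  note hull = affine_hull_facet[OF e]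
  obtain z where z: "z \<in> e" using e by auto
  have *: "n' \<bullet> w = 0" if "n \<bullet> w = 0" for w
  proof -
    have "z + w \<in> affine hull e"
      using hull[OF n] z n that by (auto simp: inner_add_right)
    then have "n' \<bullet> (z + w) = n' \<bullet> z"
      using hull[OF n'] z n' by auto
    then show ?thesis by (simp add: inner_add_right)
  qed
  \<comment> \<open>The component of \<open>n'\<close> along \<open>n\<close>. The remainder
    \<open>n' - s *\<^sub>R n\<close> is orthogonal to \<open>n\<close>, hence to \<open>n'\<close>,
    which forces \<open>s\<close> to be 1 or -1.\<close>
  define s where "s = n' \<bullet> n"
  have nn: "n \<bullet> n = 1" "n' \<bullet> n' = 1"
    using n n' by (simp_all add: norm_eq_1)
  have "n' \<bullet> (n' - s *\<^sub>R n) = 0"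
    by (rule *) (simp add: inner_diff_right s_def nn inner_commute)
  then have "s\<^sup>2 = 1"
    by (simp add: inner_diff_right nn s_def power2_eq_square)
  then have s: "s = 1 \<or> s = -1"
    by (simp add: power2_eq_1_iff)
  have "(n' - s *\<^sub>R n) \<bullet> (n' - s *\<^sub>R n) = 1 - s\<^sup>2"
    by (simp add: inner_diff_right inner_diff_left nn s_def inner_commute power2_eq_square algebra_simps)
  then have "n' = s *\<^sub>R n"
    using \<open>s\<^sup>2 = 1\<close> by simp
  then show ?thesis using s by auto
qed

text \<open>Near a relative interior point of a facet, a convex body fills the half space below the
  facet: shooting from an interior point \<open>p\<close> through \<open>x\<close> hits the facet close to \<open>z\<close>.\<close>

lemma half_ball_subset:
  fixes n :: "'a::euclidean_space"
  assumes K: "convex K" "e \<subseteq> K" and hull: "affine hull e = {x. n \<bullet> x = b}" and n: "norm n = 1"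
    and p: "p \<in> K" "n \<bullet> p < b" and z: "z \<in> rel_interior e"
  shows "\<exists>\<epsilon>>0. ball z \<epsilon> \<inter> {x. n \<bullet> x \<le> b} \<subseteq> K"
proof -
  obtain \<delta> where \<delta>: "\<delta> > 0" "ball z \<delta> \<inter> affine hull e \<subseteq> e" and ze: "z \<in> e"
    using z by (auto simp: mem_rel_interior_ball)
  have nz: "n \<bullet> z = b"
    using ze hull hull_subset[of e affine] by auto
  define s where "s = b - n \<bullet> p"
  define M where "M = norm (p - z)"
  \<comment> \<open>The first bound keeps \<open>t \<le> 1 / 2\<close>, so projecting from
    \<open>p\<close> stretches by at most 2. The second keeps the stretched distance
    \<open>2 * (\<epsilon> + (\<epsilon> / s) * M)\<close> within \<open>\<delta>\<close>.\<close>
  define \<epsilon> where "\<epsilon> = min (s / 2) (\<delta> / (2 * (1 + M / s)))"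
  have s: "s > 0" and M: "M \<ge> 0" using p by (auto simp: s_def M_def)
  then have Ms: "1 + M / s > 0" by (simp add: add_pos_nonneg)
  have \<epsilon>: "\<epsilon> > 0" "\<epsilon> \<le> s / 2" "2 * \<epsilon> * (1 + M / s) \<le> \<delta>"
  proof -
    show "\<epsilon> > 0" using s Ms \<delta> by (simp add: \<epsilon>_def)
    show "\<epsilon> \<le> s / 2" unfolding \<epsilon>_def by (rule min.cobounded1)
    have "\<epsilon> \<le> \<delta> / (2 * (1 + M / s))" by (simp add: \<epsilon>_def)
    then have "\<epsilon> * (2 * (1 + M / s)) \<le> \<delta>" using Ms by (simp add: pos_le_divide_eq)
    then show "2 * \<epsilon> * (1 + M / s) \<le> \<delta>" by (simp add: mult_ac)
  qed
  have "x \<in> K" if x: "x \<in> ball z \<epsilon>" "n \<bullet> x \<le> b" for x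
  proof -
    define t where "t = (b - n \<bullet> x) / s"
    have xz: "norm (x - z) < \<epsilon>"
      using x by (simp add: dist_norm norm_minus_commute)
    have "b - n \<bullet> x = n \<bullet> (z - x)" by (simp add: inner_diff_right nz)
    also have "\<dots> \<le> norm (x - z)"
      using norm_cauchy_schwarz[of n "z - x"] n by (simp add: norm_minus_commute)
    finally have bx: "b - n \<bullet> x \<le> norm (x - z)" .
    have t0: "t \<ge> 0" using x s by (simp add: t_def)
    have te: "t \<le> \<epsilon> / s" using bx xz s by (simp add: t_def divide_right_mono)
    also have "\<dots> \<le> 1 / 2" using \<epsilon> s by (simp add: field_simps)
    finally have t1: "t \<le> 1 / 2" .
    \<comment> \<open>The point where the ray from \<open>p\<close> through \<open>x\<close> meets
      the hyperplane; \<open>x\<close> lies between \<open>p\<close> and \<open>y\<close>.\<close>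
    define y where "y = (1 / (1 - t)) *\<^sub>R (x - t *\<^sub>R p)"
    have xy: "x = (1 - t) *\<^sub>R y + t *\<^sub>R p"
      using t1 by (simp add: y_def)
    have ts: "t * s = b - n \<bullet> x" using s by (simp add: t_def)
    have "n \<bullet> x - t * (n \<bullet> p) = (1 - t) * b"
      using ts by (simp add: s_def algebra_simps)
    then have "n \<bullet> y = b" using t1 by (simp add: y_def inner_diff_right)
    moreover have "norm (y - z) < \<delta>"
    proof -
      have "y - z = (1 / (1 - t)) *\<^sub>R ((x - t *\<^sub>R p) - (1 - t) *\<^sub>R z)"
        using t1 by (simp add: y_def scaleR_diff_right)
      also have "(x - t *\<^sub>R p) - (1 - t) *\<^sub>R z = (x - z) - t *\<^sub>R (p - z)"
        by (simp add: algebra_simps)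
      finally have "norm (y - z) = (1 / (1 - t)) * norm ((x - z) - t *\<^sub>R (p - z))"
        using t1 by simp
      also have "\<dots> \<le> 2 * norm ((x - z) - t *\<^sub>R (p - z))"
        using t1 by (intro mult_right_mono) (auto simp: divide_simps)
      also have "norm ((x - z) - t *\<^sub>R (p - z)) \<le> norm (x - z) + t * M"
        using norm_triangle_ineq4[of "x - z" "t *\<^sub>R (p - z)"] t0 by (simp add: M_def)
      also have "\<dots> < \<epsilon> + (\<epsilon> / s) * M"
        using xz mult_right_mono[OF te M] by linarith
      also have "2 * (\<epsilon> + (\<epsilon> / s) * M) = 2 * \<epsilon> * (1 + M / s)"
        by (simp add: algebra_simps)
      finally show ?thesis using \<epsilon> by simp
    qed
    ultimately have "y \<in> e"
      using \<delta> hull by (auto simp: dist_norm norm_minus_commute)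
    then show ?thesis
      using xy K p t0 t1 convexD[OF K(1), of y p "1 - t" t] by auto
  qed
  then show ?thesis using \<epsilon>(1) by blast
qed

text \<open>The domain does not occur: normals, adjacency and jumps concern only the finite family
  of simplices. Dimension at least two makes every facet more than a point, so that the weights
  \<open>lam / diameter e\<close> have a positive denominator.\<close>

locale simplicial_mesh =
  fixes \<T> :: "(real^'d) set set"
  assumes triangulation: "triangulation \<T>"
    and element_simplex: "\<And>K. K \<in> \<T> \<Longrightarrow> int CARD('d) simplex K"
    and dim_ge_2: "CARD('d) \<ge> 2"
begin

lemma finite_mesh: "finite \<T>"
  using triangulation by (simp add: triangulation_def)

lemma element:
  assumes "K \<in> \<T>"
  shows "polytope K" "convex K" "compact K" "aff_dim K = int CARD('d)" "interior K \<noteq> {}"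
    "K \<in> sets lebesgue"
proof -
  note s = element_simplex[OF assms]
  show "polytope K" using s by (rule simplex_imp_polytope)
  show c: "convex K" using s by (rule convex_simplex)
  show "compact K" using s by (rule compact_simplex)
  then show "K \<in> sets lebesgue"
    by (simp add: lmeasurable_compact fmeasurableD)
  show a: "aff_dim K = int CARD('d)" using s by (rule aff_dim_simplex)
  then have "affine hull K = UNIV"
    using aff_dim_eq_full[of K] by simp
  moreover have "K \<noteq> {}" using a by auto
  ultimately show "interior K \<noteq> {}"
    using c rel_interior_interior[of K] rel_interior_eq_empty[of K] by simp
qed

lemma finite_mesh_faces: "finite (mesh_faces \<T>)"
proof -
  have "mesh_faces \<T> = (\<Union>K\<in>\<T>. {e. e facet_of K})"
    by (auto simp: mesh_faces_def)
  then show ?thesis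
    using finite_mesh by (auto intro!: finite_polytope_facets element(1))
qed

lemma facet:
  assumes "K \<in> \<T>" "e facet_of K"
  shows "polytope e" "convex e" "compact e" "e \<noteq> {}" "aff_dim e = int DIM(real^'d) - 1" "e \<subseteq> K"
proof -
  have f: "e face_of K" using assms by (simp add: facet_of_def)
  show "polytope e" using f element[OF assms(1)] face_of_polytope_polytope by blast
  then show "convex e" "compact e" by (auto simp: polytope_imp_convex polytope_imp_compact)
  show "e \<noteq> {}" "aff_dim e = int DIM(real^'d) - 1" "e \<subseteq> K"
    using assms element[OF assms(1)] by (auto simp: facet_of_def face_of_imp_subset)
qed

text \<open>Existence comes from a supporting hyperplane, since every facet of a polytope is
  exposed. This shows that the description in \<open>outward_normal\<close> denotes.\<close>

lemma outward_normal:
  assumes K: "K \<in> \<T>" and e: "e facet_of K"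
  obtains b where "norm (outward_normal K e) = 1" "e \<subseteq> {x. outward_normal K e \<bullet> x = b}"
    "K \<subseteq> {x. outward_normal K e \<bullet> x \<le> b}" "affine hull e = {x. outward_normal K e \<bullet> x = b}"
proof -
  note el = element[OF K] and fa = facet[OF K e]
  have "e exposed_face_of K"
    using e el by (simp add: exposed_face_of_polyhedron polytope_imp_polyhedron facet_of_def)
  then obtain a c where ac: "K \<subseteq> {x. a \<bullet> x \<le> c}" "e = K \<inter> {x. a \<bullet> x = c}"
    by (auto simp: exposed_face_of_def)
  have "a \<noteq> 0"
  proof
    assume "a = 0"
    then have "e = K \<or> e = {}" using ac by auto
    then show False using fa el by auto
  qed
  define n where "n = (1 / norm a) *\<^sub>R a"
  have n: "norm n = 1 \<and> (\<exists>b. e \<subseteq> {x. n \<bullet> x = b} \<and> K \<subseteq> {x. n \<bullet> x \<le> b})"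
    using \<open>a \<noteq> 0\<close> ac by (intro conjI exI[of _ "c / norm a"]) (auto simp: n_def divide_right_mono)
  have uniq: "n' = n" if n': "norm n' = 1 \<and> (\<exists>b. e \<subseteq> {x. n' \<bullet> x = b} \<and> K \<subseteq> {x. n' \<bullet> x \<le> b})" for n'
  proof (rule ccontr)
    assume "n' \<noteq> n"
    obtain b b' where b: "e \<subseteq> {x. n \<bullet> x = b}" "K \<subseteq> {x. n \<bullet> x \<le> b}"
      "e \<subseteq> {x. n' \<bullet> x = b'}" "K \<subseteq> {x. n' \<bullet> x \<le> b'}"
      using n n' by blast
    \<comment> \<open>The opposite normal would put \<open>K\<close> on both sides of the hyperplane
      and so inside it, although \<open>K\<close> has interior points.\<close>
    then have "n' = - n"
      using hyperplane_unit_normal_unique[of e n b n' b'] fa n n' \<open>n' \<noteq> n\<close> by auto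
    obtain z where "z \<in> e" using fa by auto
    then have "b' = - b" using b \<open>n' = - n\<close> by auto
    then have "K \<subseteq> {x. n \<bullet> x = b}" using b \<open>n' = - n\<close> by fastforce
    moreover have "interior {x. n \<bullet> x = b} = {}"
      using n by (intro interior_hyperplane) auto
    ultimately show False using el interior_mono by blast
  qed
  have "outward_normal K e = n"
    unfolding outward_normal_def using n uniq by (rule the_equality)
  with n obtain b where "norm (outward_normal K e) = 1" "e \<subseteq> {x. outward_normal K e \<bullet> x = b}"
    "K \<subseteq> {x. outward_normal K e \<bullet> x \<le> b}" by blast
  then show ?thesis
    using that affine_hull_facet[of e "outward_normal K e" b] fa by blast
qed

lemma element_half_ball:
  assumes K: "K \<in> \<T>" and e: "e facet_of K" and z: "z \<in> rel_interior e"
  shows "\<exists>\<epsilon>>0. ball z \<epsilon> \<inter> {x. outward_normal K e \<bullet> x \<le> outward_normal K e \<bullet> z} \<subseteq> K"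
proof -
  note el = element[OF K] and fa = facet[OF K e]
  obtain b where n: "norm (outward_normal K e) = 1" "e \<subseteq> {x. outward_normal K e \<bullet> x = b}"
    "K \<subseteq> {x. outward_normal K e \<bullet> x \<le> b}" "affine hull e = {x. outward_normal K e \<bullet> x = b}"
    using outward_normal[OF K e] .
  have "interior {x. outward_normal K e \<bullet> x = b} = {}"
    using n by (intro interior_hyperplane) auto
  then have "\<not> K \<subseteq> {x. outward_normal K e \<bullet> x = b}"
    using el(5) interior_mono by blast
  then obtain p where p: "p \<in> K" "outward_normal K e \<bullet> p < b"
    using n(3) by fastforce
  have "outward_normal K e \<bullet> z = b"
    using z n(2) rel_interior_subset by blast
  then show ?thesis
    using half_ball_subset[OF el(2) fa(6) n(4) n(1) p z] by simp
qed

text \<open>The intersection is a face of either element. A proper face has smaller dimension and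
  cannot contain a nonempty open set.\<close>

lemma elements_eq_if_interiors_meet:
  assumes K: "K \<in> \<T>" "K' \<in> \<T>" and U: "open U" "U \<noteq> {}" "U \<subseteq> K" "U \<subseteq> K'"
  shows "K = K'"
proof -
  have *: "K \<inter> K' = K" if "K \<in> \<T>" "K' \<in> \<T>" "U \<subseteq> K" "U \<subseteq> K'" for K K'
  proof (rule ccontr)
    assume "K \<inter> K' \<noteq> K"
    moreover have "(K \<inter> K') face_of K"
      using triangulation that by (simp add: triangulation_def)
    ultimately have "aff_dim (K \<inter> K') < aff_dim K"
      using element(2)[OF that(1)] face_of_aff_dim_lt by blast
    moreover have "aff_dim U \<le> aff_dim (K \<inter> K')"
      using that by (intro aff_dim_subset) auto
    ultimately show False
      using aff_dim_open[OF U(1,2)] element(4)[OF that(1)] by simp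
  qed
  show ?thesis using *[of K K'] *[of K' K] assms by auto
qed

text \<open>Near a relative interior point of \<open>e\<close> both elements fill the same half
  ball, so they share an open set. With \<open>adjacent_opposite_normal\<close>, at most two
  elements are adjacent to a face.\<close>

lemma adjacent_same_normal:
  assumes K: "K \<in> adjacent \<T> e" "K' \<in> adjacent \<T> e"
    and n: "outward_normal K e = outward_normal K' e"
  shows "K = K'"
proof -
  have KT: "K \<in> \<T>" "e facet_of K" "K' \<in> \<T>" "e facet_of K'"
    using K by (auto simp: adjacent_def)
  let ?n = "outward_normal K e"
  have n1: "norm ?n = 1" using outward_normal[OF KT(1,2)] .
  have "rel_interior e \<noteq> {}"
    using facet[OF KT(1,2)] rel_interior_eq_empty by blast
  then obtain z where z: "z \<in> rel_interior e" by blast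
  obtain \<epsilon> \<epsilon>' where \<epsilon>: "\<epsilon> > 0" "ball z \<epsilon> \<inter> {x. ?n \<bullet> x \<le> ?n \<bullet> z} \<subseteq> K"
    "\<epsilon>' > 0" "ball z \<epsilon>' \<inter> {x. ?n \<bullet> x \<le> ?n \<bullet> z} \<subseteq> K'"
    using element_half_ball[OF KT(1,2) z] element_half_ball[OF KT(3,4) z] n by auto
  let ?\<delta> = "min \<epsilon> \<epsilon>'"
  let ?U = "ball z ?\<delta> \<inter> {x. ?n \<bullet> x < ?n \<bullet> z}"
  have "z - (?\<delta> / 2) *\<^sub>R ?n \<in> ?U"
    using \<epsilon>(1,3) n1 norm_eq_1[of ?n] by (auto simp: dist_norm inner_diff_right)
  then have "?U \<noteq> {}" by blast
  moreover have "open ?U" by (intro open_Int open_ball open_halfspace_lt)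
  moreover have "?U \<subseteq> K" "?U \<subseteq> K'" using \<epsilon> by auto
  ultimately show ?thesis
    using elements_eq_if_interiors_meet[OF KT(1,3)] by blast
qed

lemma adjacent_opposite_normal:
  assumes K: "K \<in> adjacent \<T> e" "K' \<in> adjacent \<T> e" "K \<noteq> K'"
  shows "outward_normal K' e = - outward_normal K e"
proof -
  have KT: "K \<in> \<T>" "e facet_of K" "K' \<in> \<T>" "e facet_of K'"
    using K by (auto simp: adjacent_def)
  obtain b where b: "norm (outward_normal K e) = 1" "e \<subseteq> {x. outward_normal K e \<bullet> x = b}"
    using outward_normal[OF KT(1,2)] .
  obtain b' where b': "norm (outward_normal K' e) = 1" "e \<subseteq> {x. outward_normal K' e \<bullet> x = b'}"
    using outward_normal[OF KT(3,4)] .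
  show ?thesis
    using hyperplane_unit_normal_unique[OF _ _ b b'] facet[OF KT(1,2)] adjacent_same_normal K
    by metis
qed

text \<open>The union \<open>S\<close> of the elements that carry a fixed nonzero value has no facet on its
  boundary, so its frontier has codimension two.  A generic segment from the interior of \<open>S\<close> to a
  point outside avoids a set of codimension two, which contradicts connectedness.\<close>

lemma jump_free_constants_vanish:
  assumes jump: "\<And>e. e \<in> mesh_faces \<T> \<Longrightarrow> (\<Sum>K\<in>adjacent \<T> e. c K *\<^sub>R outward_normal K e) = 0"
    and K0: "K0 \<in> \<T>"
  shows "c K0 = (0::real)"
proof (rule ccontr)
  assume m: "c K0 \<noteq> 0"
  define \<S> where "\<S> = {K \<in> \<T>. c K = c K0}"
  define S where "S = \<Union>\<S>"
  \<comment> \<open>Facets of facets, of dimension \<open>CARD('d) - 2\<close>.\<close>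
  define \<C> where "\<C> = {g. \<exists>K\<in>\<S>. \<exists>e. e facet_of K \<and> g facet_of e}"
  have fS: "finite \<S>" using finite_mesh by (simp add: \<S>_def)
  have compS: "compact S"
    unfolding S_def using fS element(3) by (intro compact_Union) (auto simp: \<S>_def)
  have "finite \<C>"
  proof -
    have "\<C> = (\<Union>K\<in>\<S>. \<Union>e\<in>{e. e facet_of K}. {g. g facet_of e})"
      by (auto simp: \<C>_def)
    then show ?thesis
      using fS by (auto simp: \<S>_def
          intro!: finite_UN_I[OF finite_polytope_facets[OF element(1)]] finite_polytope_facets[OF facet(1)])
  qed
  have Csub: "g \<subseteq> S" if "g \<in> \<C>" for g
    using that unfolding \<C>_def S_def by (blast dest: facet_of_imp_subset)
  have Cdim: "aff_dim g = int CARD('d) - 2" if "g \<in> \<C>" for g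
  proof -
    obtain K e where "K \<in> \<S>" "e facet_of K" "g facet_of e" using \<open>g \<in> \<C>\<close> by (auto simp: \<C>_def)
    then show ?thesis using facet(5)[of K e] by (auto simp: \<S>_def facet_of_def)
  qed
  have front: "x \<in> \<Union>\<C>" if x: "x \<in> frontier S" for x
  proof -
    have "x \<in> S" "x \<notin> interior S"
      using x compS by (auto simp: frontier_def compact_imp_closed)
    then obtain K where K: "K \<in> \<S>" "x \<in> K" by (auto simp: S_def)
    then have KT: "K \<in> \<T>" and cK: "c K = c K0" by (auto simp: \<S>_def)
    note el = element[OF KT]
    have "K \<subseteq> S" using K by (auto simp: S_def)
    then have "x \<notin> rel_interior K"
      using \<open>x \<notin> interior S\<close> interior_mono[of K S] rel_interior_interior[of K] el(4)
        aff_dim_eq_full[of K] by auto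
    then have "x \<in> \<Union> {e. e facet_of K}"
      using K rel_boundary_of_polyhedron[of K] el(1) polytope_imp_polyhedron by auto
    then obtain e where e: "e facet_of K" "x \<in> e" by blast
    have "x \<notin> rel_interior e"
    proof
      \<comment> \<open>At a relative interior point of a facet an equal value continues on the
        other side, and two opposite half balls fill a whole ball inside \<open>S\<close>.\<close>
      assume xe: "x \<in> rel_interior e"
      have Kad: "K \<in> adjacent \<T> e" using KT e by (simp add: adjacent_def)
      let ?n = "outward_normal K e"
      have n1: "norm ?n = 1" using outward_normal[OF KT e(1)] .
      have sum: "(\<Sum>L\<in>adjacent \<T> e. c L *\<^sub>R outward_normal L e) = 0"
        using KT e by (intro jump) (auto simp: mesh_faces_def)
      \<comment> \<open>With \<open>K\<close> alone, as on a boundary face, the jump would be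
        \<open>c K\<close> times a unit vector, which is nonzero.\<close>
      have "adjacent \<T> e \<noteq> {K}"
        using sum cK m n1 by auto
      then obtain K' where K': "K' \<in> adjacent \<T> e" "K' \<noteq> K" using Kad by blast
      have n': "outward_normal K' e = - ?n"
        using adjacent_opposite_normal[OF Kad K'(1)] K' by simp
      have "adjacent \<T> e = {K, K'}"
      proof -
        have "L = K'" if "L \<in> adjacent \<T> e" "L \<noteq> K" for L
          using adjacent_same_normal[OF that(1) K'(1)] adjacent_opposite_normal[OF Kad that(1)] n'
            that by metis
        then show ?thesis using Kad K' by blast
      qed
      then have "(c K - c K') *\<^sub>R ?n = 0"
        using sum K' n' by (simp add: algebra_simps)
      then have "c K' = c K0" using n1 cK by auto
      then have "K' \<in> \<S>" using K' by (auto simp: \<S>_def adjacent_def)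
      then have "K' \<subseteq> S" by (auto simp: S_def)
      have K'T: "K' \<in> \<T>" "e facet_of K'" using K' by (auto simp: adjacent_def)
      obtain \<epsilon> \<epsilon>' where \<epsilon>: "\<epsilon> > 0" "ball x \<epsilon> \<inter> {y. ?n \<bullet> y \<le> ?n \<bullet> x} \<subseteq> K"
        "\<epsilon>' > 0" "ball x \<epsilon>' \<inter> {y. - ?n \<bullet> y \<le> - ?n \<bullet> x} \<subseteq> K'"
        using element_half_ball[OF KT e(1) xe] element_half_ball[OF K'T xe] n' by metis
      have "ball x (min \<epsilon> \<epsilon>') \<subseteq> S"
      proof
        fix y assume y: "y \<in> ball x (min \<epsilon> \<epsilon>')"
        show "y \<in> S"
        proof (cases "?n \<bullet> y \<le> ?n \<bullet> x")
          case True
          then have "y \<in> K" using \<epsilon>(2) y by auto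
          then show ?thesis using \<open>K \<subseteq> S\<close> by blast
        next
          case False
          then have "y \<in> K'" using \<epsilon>(4) y by auto
          then show ?thesis using \<open>K' \<subseteq> S\<close> by blast
        qed
      qed
      moreover have "x \<in> ball x (min \<epsilon> \<epsilon>')" using \<epsilon> by simp
      ultimately have "x \<in> interior S" by (meson interiorI open_ball)
      then show False using \<open>x \<notin> interior S\<close> by blast
    qed
    then have "x \<in> \<Union> {g. g facet_of e}"
      using e rel_boundary_of_polyhedron[of e] facet(1)[OF KT e(1)] polytope_imp_polyhedron by auto
    then show ?thesis using K e by (auto simp: \<C>_def)
  qed
  have "K0 \<subseteq> S" using K0 by (auto simp: S_def \<S>_def)
  then have intS: "interior S \<noteq> {}" using element(5)[OF K0] interior_mono by blast
  have "S \<noteq> UNIV" using compS not_bounded_UNIV compact_imp_bounded by blast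
  then obtain y where y: "y \<notin> S" by blast
  \<comment> \<open>If the segment from \<open>x\<close> to \<open>y\<close> meets \<open>g\<close>
    in a point other than \<open>y\<close>, then \<open>x\<close> lies in the affine span of
    \<open>y\<close> and \<open>g\<close>. These spans have dimension at most
    \<open>CARD('d) - 1\<close>, hence measure zero.\<close>
  define N where "N = (\<Union>g\<in>\<C>. affine hull (insert y g))"
  have "negligible N"
    unfolding N_def
  proof (rule negligible_Union, goal_cases)
    case 1 show ?case using \<open>finite \<C>\<close> by simp
  next
    case (2 t)
    then obtain g where g: "g \<in> \<C>" "t = affine hull (insert y g)" by auto
    have "aff_dim t < int DIM(real^'d)"
      using Cdim[OF g(1)] g(2) by (simp add: aff_dim_affine_hull aff_dim_insert)
    moreover have "convex t" using g by (simp add: affine_imp_convex)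
    ultimately show ?case
      using negligible_convex_interior[of t] aff_dim_nonempty_interior[of t] by fastforce
  qed
  then have "\<not> interior S \<subseteq> N"
    using intS open_not_negligible[OF open_interior] negligible_subset by blast
  then obtain x where x: "x \<in> interior S" "x \<notin> N" by blast
  have "closed_segment x y \<inter> frontier S \<noteq> {}"
    using x y interior_subset
    by (intro connected_Int_frontier connected_segment) auto
  then obtain z where z: "z \<in> closed_segment x y" "z \<in> frontier S" by blast
  then obtain g where g: "g \<in> \<C>" "z \<in> g" using front by blast
  have "z \<noteq> y" using g Csub y by blast
  have "x \<in> affine hull (insert y g)"
  proof -
    obtain t where t: "z = (1 - t) *\<^sub>R x + t *\<^sub>R y" "0 \<le> t" "t \<le> 1"
      using z by (auto simp: closed_segment_def)
    then have "t \<noteq> 1" using \<open>z \<noteq> y\<close> by auto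
    have "(1 - t) *\<^sub>R x = z - t *\<^sub>R y" using t by simp
    then have "(1 / (1 - t)) *\<^sub>R ((1 - t) *\<^sub>R x) = (1 / (1 - t)) *\<^sub>R (z - t *\<^sub>R y)"
      by (rule arg_cong)
    then have "x = (1 / (1 - t)) *\<^sub>R (z - t *\<^sub>R y)"
      using \<open>t \<noteq> 1\<close> by simp
    then have "x = (1 / (1 - t)) *\<^sub>R z + (- t / (1 - t)) *\<^sub>R y"
      by (simp add: scaleR_diff_right)
    moreover have "1 / (1 - t) + - t / (1 - t) = 1"
      using \<open>t \<noteq> 1\<close> by (simp add: field_simps)
    moreover have "z \<in> affine hull (insert y g)" "y \<in> affine hull (insert y g)"
      using g by (auto intro: hull_inc)
    ultimately show ?thesis
      using mem_affine[OF affine_affine_hull] by metis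
  qed
  then show False using x g by (auto simp: N_def)
qed

end

section \<open>Surface measure\<close>

text \<open>Reduces statements on surface measure to Lebesgue measure on the compact convex prism
  over \<open>e\<close>, which has full dimension.\<close>

lemma surface_prism:
  fixes e :: "(real^'d) set"
  assumes e: "convex e" "compact e" "e \<noteq> {}" "aff_dim e = int DIM(real^'d) - 1"
  obtains P where "surface_measure e = distr (lebesgue_on P) borel (closest_point e)"
    "compact P" "\<not> negligible P" "closest_point e \<in> borel_measurable (lebesgue_on P)"
proof -
  obtain a b where "a \<noteq> 0" and ab: "affine hull e = {x. a \<bullet> x = b}"
    using aff_dim_eq_hyperplane[of e] e(4) by auto
  let ?n0 = "(1 / norm a) *\<^sub>R a"
  have "norm ?n0 = 1 \<and> (\<forall>x\<in>e. \<forall>y\<in>e. ?n0 \<bullet> (x - y) = 0)"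
    using \<open>a \<noteq> 0\<close> ab hull_subset[of e affine] by (auto simp: inner_diff_right)
  then have ex: "\<exists>n. norm n = 1 \<and> (\<forall>x\<in>e. \<forall>y\<in>e. n \<bullet> (x - y) = 0)" by blast
  define n where "n = (SOME n. norm n = 1 \<and> (\<forall>x\<in>e. \<forall>y\<in>e. n \<bullet> (x - y) = 0))"
  have n: "norm n = 1" "\<And>x y. x \<in> e \<Longrightarrow> y \<in> e \<Longrightarrow> n \<bullet> (x - y) = 0"
    using someI_ex[OF ex] by (auto simp: n_def)
  define P where "P = {y + t *\<^sub>R n | y t. y \<in> e \<and> 0 \<le> t \<and> t \<le> 1}"
  have P: "P = (\<lambda>(y, t). y + t *\<^sub>R n) ` (e \<times> {0..1})"
    unfolding P_def by (simp add: set_eq_iff image_iff Bex_def) blast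
  have "compact P"
    unfolding P using e
    by (intro compact_continuous_image compact_Times) (auto simp: case_prod_beta intro!: continuous_intros)
  have "linear (\<lambda>(y, t). y + t *\<^sub>R n)"
    by (rule linearI) (auto simp: algebra_simps)
  then have convP: "convex P"
    unfolding P using e by (intro convex_linear_image convex_Times) auto
  obtain z where z: "z \<in> e" using e(3) by auto
  have "n \<bullet> x = n \<bullet> z" if "x \<in> e" for x
    using n(2)[OF that z] by (simp add: inner_diff_right)
  then have "affine hull e \<subseteq> {x. n \<bullet> x = n \<bullet> z}"
    by (intro hull_minimal affine_hyperplane subsetI CollectI)
  moreover have "n \<bullet> (z + n) \<noteq> n \<bullet> z"
    using n(1) norm_eq_1[of n] by (simp add: inner_add_right)
  ultimately have "z + n \<notin> affine hull e" by blast
  \<comment> \<open>One point off the hyperplane of \<open>e\<close> raises the dimension to that of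
    the whole space.\<close>
  then have "aff_dim (insert (z + n) e) = int DIM(real^'d)"
    using e by (simp add: aff_dim_insert)
  moreover have "insert (z + n) e \<subseteq> P"
  proof -
    have "x \<in> P" if "x \<in> e" for x
      unfolding P using that by (intro image_eqI[of _ _ "(x, 0)"]) auto
    moreover have "z + n \<in> P"
      unfolding P using z by (intro image_eqI[of _ _ "(z, 1)"]) auto
    ultimately show ?thesis by blast
  qed
  ultimately have "int DIM(real^'d) \<le> aff_dim P"
    by (metis aff_dim_subset)
  then have "affine hull P = UNIV"
    using aff_dim_eq_full[of P] aff_dim_le_DIM[of P] by simp
  moreover have "P \<noteq> {}" using \<open>insert (z + n) e \<subseteq> P\<close> by blast
  ultimately have "interior P \<noteq> {}"
    using convP rel_interior_interior[of P] rel_interior_eq_empty[of P] by simp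
  then have "\<not> negligible P" using negligible_convex_interior[OF convP] by simp
  moreover have "closest_point e \<in> borel_measurable (lebesgue_on P)"
    using e \<open>compact P\<close>
    by (intro continuous_imp_measurable_on_sets_lebesgue continuous_on_closest_point)
      (auto simp: compact_imp_closed lmeasurable_compact fmeasurableD)
  moreover have "surface_measure e = distr (lebesgue_on P) borel (closest_point e)"
    by (simp add: surface_measure_def n_def[symmetric] P_def Let_def)
  ultimately show ?thesis using that \<open>compact P\<close> by blast
qed

lemma sets_surface_measure [simp, measurable_cong]: "sets (surface_measure e) = sets borel"
  by (simp add: surface_measure_def Let_def)

lemma space_surface_measure [simp]: "space (surface_measure e) = UNIV"
  by (simp add: surface_measure_def Let_def)

text \<open>The measure lives on the whole space, so its concentration on \<open>e\<close> has to be
  shown; it holds because \<open>closest_point e\<close> takes values in \<open>e\<close>.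
  Positivity later turns a vanishing integral of a constant jump into a vanishing jump.\<close>

lemma surface_measure_facts:
  fixes e :: "(real^'d) set"
  assumes e: "convex e" "compact e" "e \<noteq> {}" "aff_dim e = int DIM(real^'d) - 1"
  shows finite_surface_measure: "finite_measure (surface_measure e)"
    and AE_surface_measure: "AE x in surface_measure e. x \<in> e"
    and surface_measure_pos: "measure (surface_measure e) UNIV > 0"
proof -
  obtain P where P: "surface_measure e = distr (lebesgue_on P) borel (closest_point e)"
    "compact P" "\<not> negligible P" "closest_point e \<in> borel_measurable (lebesgue_on P)"
    using surface_prism[OF e] .
  interpret P: finite_measure "lebesgue_on P"
    using P by (intro finite_measure_lebesgue_on lmeasurable_compact)
  show fin: "finite_measure (surface_measure e)"
    unfolding P(1) by (rule P.finite_measure_distr[OF P(4)])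
  have "e \<in> sets borel" using e by (simp add: compact_imp_closed borel_closed)
  then show "AE x in surface_measure e. x \<in> e"
    unfolding P(1) using P(4) e
    by (subst AE_distr_iff) (auto simp: closest_point_in_set compact_imp_closed)
  have "measure (surface_measure e) UNIV = measure (lebesgue_on P) P"
    unfolding P(1) using P(4) by (simp add: measure_distr)
  also have "\<dots> = measure lebesgue P"
    using P by (simp add: measure_restrict_space lmeasurable_compact fmeasurableD)
  also have "\<dots> > 0"
  proof -
    have "measure lebesgue P \<noteq> 0"
      using P by (simp add: lmeasurable_compact negligible_iff_measure0)
    then show ?thesis by (simp add: less_le)
  qed
  finally show "measure (surface_measure e) UNIV > 0" .
qed

lemma integrable_continuous_surface_measure:
  fixes e :: "(real^'d) set" and g :: "real^'d \<Rightarrow> real"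
  assumes e: "convex e" "compact e" "e \<noteq> {}" "aff_dim e = int DIM(real^'d) - 1"
    and g: "continuous_on UNIV g"
  shows "integrable (surface_measure e) g"
proof -
  interpret finite_measure "surface_measure e"
    using finite_surface_measure[OF e] .
  have "compact (g ` e)"
    using e g continuous_on_subset by (intro compact_continuous_image) auto
  then obtain B where B: "\<And>x. x \<in> e \<Longrightarrow> norm (g x) \<le> B"
    using compact_imp_bounded bounded_iff by (metis image_eqI)
  show ?thesis
  proof (rule integrable_const_bound)
    show "AE x in surface_measure e. norm (g x) \<le> B"
      using AE_surface_measure[OF e] by eventually_elim (rule B)
    show "g \<in> borel_measurable (surface_measure e)"
      using borel_measurable_continuous_onI[OF g] by simp
  qed
qed

lemma integrable_continuous_lebesgue_on:
  fixes g :: "real^'d \<Rightarrow> real"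
  assumes K: "compact K" and g: "continuous_on K g"
  shows "integrable (lebesgue_on K) g"
proof -
  interpret finite_measure "lebesgue_on K"
    using K by (intro finite_measure_lebesgue_on lmeasurable_compact)
  have "compact (g ` K)" using K g by (intro compact_continuous_image)
  then obtain B where B: "\<And>x. x \<in> K \<Longrightarrow> norm (g x) \<le> B"
    using compact_imp_bounded bounded_iff by (metis image_eqI)
  show ?thesis
  proof (rule integrable_const_bound)
    show "AE x in lebesgue_on K. norm (g x) \<le> B" using B by (intro AE_I2) simp
    show "g \<in> borel_measurable (lebesgue_on K)"
      using K g by (intro continuous_imp_measurable_on_sets_lebesgue)
        (auto simp: lmeasurable_compact fmeasurableD)
  qed
qed

section \<open>The discontinuous Galerkin form\<close>

context simplicial_mesh
begin

lemma mesh_face: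
  assumes "e \<in> mesh_faces \<T>"
  shows "convex e" "compact e" "e \<noteq> {}" "aff_dim e = int DIM(real^'d) - 1"
    "diameter e > 0" "adjacent \<T> e \<noteq> {}"
proof -
  obtain K where K: "K \<in> \<T>" "e facet_of K" using assms by (auto simp: mesh_faces_def)
  show f: "convex e" "compact e" "e \<noteq> {}" "aff_dim e = int DIM(real^'d) - 1"
    using facet[OF K] by auto
  obtain x where x: "x \<in> e" using f by blast
  have "e \<noteq> {x}" using f dim_ge_2 by auto
  then obtain y where y: "y \<in> e" "y \<noteq> x" using x by blast
  have "dist x y \<le> diameter e"
    using diameter_bounded_bound[of e x y] x y f compact_imp_bounded by blast
  moreover have "dist x y > 0" using y by simp
  ultimately show "diameter e > 0" by linarith
  show "adjacent \<T> e \<noteq> {}" using K by (auto simp: adjacent_def)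
qed

lemma piece:
  assumes "piecewise_polynomial \<T> v" "K \<in> \<T>"
  shows "real_polynomial_function (piece v K)" "AE x in lebesgue_on K. v x = piece v K x"
proof -
  obtain p where "real_polynomial_function p" "AE x in lebesgue_on K. v x = p x"
    using assms by (auto simp: piecewise_polynomial_def)
  moreover from this have "piece v K = p"
    using piece_eqI element[OF assms(2)] by blast
  ultimately show "real_polynomial_function (piece v K)" "AE x in lebesgue_on K. v x = piece v K x"
    by auto
qed

lemma piece_linear_combination:
  assumes "piecewise_polynomial \<T> v" "piecewise_polynomial \<T> w" "K \<in> \<T>"
  shows "piece (\<lambda>x. a * v x + b * w x) K = (\<lambda>x. a * piece v K x + b * piece w K x)"
proof (rule piece_eqI)
  show "AE x in lebesgue_on K. a * v x + b * w x = a * piece v K x + b * piece w K x"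
    using piece(2)[OF assms(1,3)] piece(2)[OF assms(2,3)] by eventually_elim simp
qed (use element[OF assms(3)] in \<open>auto intro!: real_polynomial_function.intros(2-4) piece(1) assms\<close>)

lemma jump_linear_combination:
  assumes "piecewise_polynomial \<T> v" "piecewise_polynomial \<T> w"
  shows "jump \<T> e (\<lambda>x. a * v x + b * w x) x = a *\<^sub>R jump \<T> e v x + b *\<^sub>R jump \<T> e w x"
proof -
  have "piece (\<lambda>x. a * v x + b * w x) K = (\<lambda>x. a * piece v K x + b * piece w K x)"
    if "K \<in> adjacent \<T> e" for K
    using piece_linear_combination[OF assms] that by (simp add: adjacent_def)
  then show ?thesis
    by (simp add: jump_def scaleR_sum_right sum.distrib scaleR_left_distrib cong: sum.cong)
qed

lemma avg_gradient_linear_combination: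
  assumes "piecewise_polynomial \<T> v" "piecewise_polynomial \<T> w"
  shows "avg_gradient \<T> e (\<lambda>x. a * v x + b * w x) x
    = a *\<^sub>R avg_gradient \<T> e v x + b *\<^sub>R avg_gradient \<T> e w x"
proof -
  have "gradient (piece (\<lambda>x. a * v x + b * w x) K) x
      = a *\<^sub>R gradient (piece v K) x + b *\<^sub>R gradient (piece w K) x"
    if "K \<in> adjacent \<T> e" for K
    using that piece(1)[OF assms(1)] piece(1)[OF assms(2)]
    by (simp add: adjacent_def piece_linear_combination[OF assms] gradient_linear_combination)
  then show ?thesis
    by (simp add: avg_gradient_def scaleR_sum_right sum.distrib scaleR_right_distrib mult.commute
        cong: sum.cong)
qed

lemma continuous_on_jump:
  assumes "piecewise_polynomial \<T> v"
  shows "continuous_on S (jump \<T> e v)"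
  unfolding jump_def
proof (intro continuous_on_sum continuous_on_scaleR continuous_on_const)
  fix K assume "K \<in> adjacent \<T> e"
  then have "real_polynomial_function (piece v K)"
    using piece(1)[OF assms] by (simp add: adjacent_def)
  then show "continuous_on S (piece v K)"
    by (simp add: differentiable_imp_continuous_on differentiable_on_real_polynomial_function)
qed

lemma continuous_on_avg_gradient:
  assumes "piecewise_polynomial \<T> v"
  shows "continuous_on S (avg_gradient \<T> e v)"
  unfolding avg_gradient_def
proof (intro continuous_on_sum continuous_on_scaleR continuous_on_const)
  fix K assume "K \<in> adjacent \<T> e"
  then have "real_polynomial_function (piece v K)"
    using piece(1)[OF assms] by (simp add: adjacent_def)
  then show "continuous_on S (gradient (piece v K))"
    by (rule continuous_on_gradient)
qed

lemma DG_form_commute: "DG_form \<T> lam w v = DG_form \<T> lam v w"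
  by (simp add: DG_form_def inner_commute)

text \<open>Each of the four sums is treated separately. The traces and gradients are continuous,
  hence integrable on elements and faces, which additivity of the integral requires. The second
  argument follows by \<open>DG_form_commute\<close>.\<close>

lemma DG_form_linear_combination:
  assumes v: "piecewise_polynomial \<T> v" and w: "piecewise_polynomial \<T> w"
    and u: "piecewise_polynomial \<T> u"
  shows "DG_form \<T> lam (\<lambda>x. a * v x + b * w x) u = a * DG_form \<T> lam v u + b * DG_form \<T> lam w u"
proof -
  have lin: "(LINT x|M. a * g x + b * h x) = a * (LINT x|M. g x) + b * (LINT x|M. h x)"
    if "integrable M g" "integrable M h" for M :: "(real^'d) measure" and g h
    using that by simp
  have "(LINT x|lebesgue_on K. gradient (piece (\<lambda>x. a * v x + b * w x) K) x \<bullet> gradient (piece u K) x)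
      = a * (LINT x|lebesgue_on K. gradient (piece v K) x \<bullet> gradient (piece u K) x)
      + b * (LINT x|lebesgue_on K. gradient (piece w K) x \<bullet> gradient (piece u K) x)"
    (is "?L1 K = a * ?V1 K + b * ?W1 K") if K: "K \<in> \<T>" for K
  proof -
    note p = piece(1)[OF v K] piece(1)[OF w K] piece(1)[OF u K]
    have "integrable (lebesgue_on K) (\<lambda>x. gradient (piece v K) x \<bullet> gradient (piece u K) x)"
      "integrable (lebesgue_on K) (\<lambda>x. gradient (piece w K) x \<bullet> gradient (piece u K) x)"
      using p element[OF K]
      by (auto intro!: integrable_continuous_lebesgue_on continuous_on_inner continuous_on_gradient)
    note lin[OF this]
    then show ?thesis
      by (simp add: piece_linear_combination[OF v w K] gradient_linear_combination p inner_add_left)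
  qed
  then have 1: "(\<Sum>K\<in>\<T>. ?L1 K) = a * (\<Sum>K\<in>\<T>. ?V1 K) + b * (\<Sum>K\<in>\<T>. ?W1 K)"
    by (simp add: sum.distrib sum_distrib_left)
  have S: "integrable (surface_measure e) (\<lambda>x. avg_gradient \<T> e f x \<bullet> jump \<T> e g x)"
    "integrable (surface_measure e) (\<lambda>x. c * (jump \<T> e f x \<bullet> jump \<T> e g x))"
    if "e \<in> mesh_faces \<T>" "piecewise_polynomial \<T> f" "piecewise_polynomial \<T> g" for e f g c
    using that mesh_face[OF that(1)]
    by (auto intro!: integrable_continuous_surface_measure continuous_on_inner
        continuous_on_avg_gradient continuous_on_jump)
  have "(LINT x|surface_measure e. avg_gradient \<T> e (\<lambda>x. a * v x + b * w x) x \<bullet> jump \<T> e u x)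
      = a * (LINT x|surface_measure e. avg_gradient \<T> e v x \<bullet> jump \<T> e u x)
      + b * (LINT x|surface_measure e. avg_gradient \<T> e w x \<bullet> jump \<T> e u x)"
    (is "?L2 e = a * ?V2 e + b * ?W2 e") if e: "e \<in> mesh_faces \<T>" for e
    using lin[OF S(1)[OF e v u] S(1)[OF e w u]]
    by (simp add: avg_gradient_linear_combination[OF v w] inner_add_left)
  then have 2: "(\<Sum>e\<in>mesh_faces \<T>. ?L2 e) = a * (\<Sum>e\<in>mesh_faces \<T>. ?V2 e) + b * (\<Sum>e\<in>mesh_faces \<T>. ?W2 e)"
    by (simp add: sum.distrib sum_distrib_left)
  have "(LINT x|surface_measure e. avg_gradient \<T> e u x \<bullet> jump \<T> e (\<lambda>x. a * v x + b * w x) x)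
      = a * (LINT x|surface_measure e. avg_gradient \<T> e u x \<bullet> jump \<T> e v x)
      + b * (LINT x|surface_measure e. avg_gradient \<T> e u x \<bullet> jump \<T> e w x)"
    (is "?L3 e = a * ?V3 e + b * ?W3 e") if e: "e \<in> mesh_faces \<T>" for e
    using lin[OF S(1)[OF e u v] S(1)[OF e u w]]
    by (simp add: jump_linear_combination[OF v w] inner_add_right)
  then have 3: "(\<Sum>e\<in>mesh_faces \<T>. ?L3 e) = a * (\<Sum>e\<in>mesh_faces \<T>. ?V3 e) + b * (\<Sum>e\<in>mesh_faces \<T>. ?W3 e)"
    by (simp add: sum.distrib sum_distrib_left)
  have "(LINT x|surface_measure e. (lam / diameter e) * (jump \<T> e (\<lambda>x. a * v x + b * w x) x \<bullet> jump \<T> e u x))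
      = a * (LINT x|surface_measure e. (lam / diameter e) * (jump \<T> e v x \<bullet> jump \<T> e u x))
      + b * (LINT x|surface_measure e. (lam / diameter e) * (jump \<T> e w x \<bullet> jump \<T> e u x))"
    (is "?L4 e = a * ?V4 e + b * ?W4 e") if e: "e \<in> mesh_faces \<T>" for e
  proof -
    have "(lam / diameter e) * (jump \<T> e (\<lambda>x. a * v x + b * w x) x \<bullet> jump \<T> e u x)
        = a * ((lam / diameter e) * (jump \<T> e v x \<bullet> jump \<T> e u x))
        + b * ((lam / diameter e) * (jump \<T> e w x \<bullet> jump \<T> e u x))" for x
      unfolding jump_linear_combination[OF v w] inner_add_left inner_scaleR_left
      by (simp only: distrib_left mult.left_commute)
    then show ?thesis
      using lin[OF S(2)[OF e v u, of "lam / diameter e"] S(2)[OF e w u, of "lam / diameter e"]]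
      by (simp only:)
  qed
  then have 4: "(\<Sum>e\<in>mesh_faces \<T>. ?L4 e) = a * (\<Sum>e\<in>mesh_faces \<T>. ?V4 e) + b * (\<Sum>e\<in>mesh_faces \<T>. ?W4 e)"
    by (simp only: sum.distrib sum_distrib_left cong: sum.cong)
  show ?thesis
    unfolding DG_form_def 1 2 3 4 by (simp only: distrib_left right_diff_distrib)
qed

lemma DG_norm_zero:
  assumes v: "piecewise_polynomial \<T> v" and lam: "lam > 0" and zero: "DG_norm \<T> lam v = 0"
    and K: "K \<in> \<T>"
  shows "piece v K = (\<lambda>x. 0)"
proof -
  define G where "G K = (LINT x|lebesgue_on K. (norm (gradient (piece v K) x))\<^sup>2)" for K
  define A where "A e = (diameter e / lam) * (LINT x|surface_measure e. (norm (avg_gradient \<T> e v x))\<^sup>2)" for e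
  define J where "J e = (lam / diameter e) * (LINT x|surface_measure e. (norm (jump \<T> e v x))\<^sup>2)" for e
  have nonneg: "G K \<ge> 0" "A e \<ge> 0" "J e \<ge> 0" if "e \<in> mesh_faces \<T>" for e K
    using lam mesh_face(5)[OF that] by (auto simp: G_def A_def J_def intro!: mult_nonneg_nonneg)
  have G0: "G K \<ge> 0" for K by (simp add: G_def)
  have "(\<Sum>K\<in>\<T>. G K) + (\<Sum>e\<in>mesh_faces \<T>. A e) + (\<Sum>e\<in>mesh_faces \<T>. J e) = 0"
    using zero by (simp add: DG_norm_def G_def A_def J_def)
  moreover have "(\<Sum>K\<in>\<T>. G K) \<ge> 0" "(\<Sum>e\<in>mesh_faces \<T>. A e) \<ge> 0" "(\<Sum>e\<in>mesh_faces \<T>. J e) \<ge> 0"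
    using nonneg G0 by (auto intro: sum_nonneg)
  ultimately have "(\<Sum>K\<in>\<T>. G K) = 0" "(\<Sum>e\<in>mesh_faces \<T>. J e) = 0"
    by linarith+
  then have G: "\<And>K. K \<in> \<T> \<Longrightarrow> G K = 0" and J: "\<And>e. e \<in> mesh_faces \<T> \<Longrightarrow> J e = 0"
    using sum_nonneg_eq_0_iff[OF finite_mesh, of G] G0 sum_nonneg_eq_0_iff[OF finite_mesh_faces, of J] nonneg
    by auto
  \<comment> \<open>The piece is a polynomial on the whole space, so it may be evaluated at 0 even
    if 0 lies outside \<open>K\<close>.\<close>
  define c where "c K = piece v K 0" for K
  have const: "piece v K x = c K" if K: "K \<in> \<T>" for K x
    unfolding c_def
  proof (rule gradient_zero_if_AE)
    show p: "real_polynomial_function (piece v K)" using piece(1)[OF v K] .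
    have "integrable (lebesgue_on K) (\<lambda>x. (norm (gradient (piece v K) x))\<^sup>2)"
      using element[OF K] p
      by (intro integrable_continuous_lebesgue_on continuous_on_power continuous_on_norm continuous_on_gradient)
    then have "AE x in lebesgue_on K. (norm (gradient (piece v K) x))\<^sup>2 = 0"
      using G[OF K] by (subst integral_nonneg_eq_0_iff_AE[symmetric]) (auto simp: G_def)
    then show "AE x in lebesgue_on K. gradient (piece v K) x = 0" by simp
  qed (use element[OF K] in auto)
  have jump0: "(\<Sum>K\<in>adjacent \<T> e. c K *\<^sub>R outward_normal K e) = 0" if e: "e \<in> mesh_faces \<T>" for e
  proof -
    let ?j = "\<Sum>K\<in>adjacent \<T> e. c K *\<^sub>R outward_normal K e"
    have "jump \<T> e v x = ?j" for x
      unfolding jump_def by (rule sum.cong) (auto simp: const adjacent_def)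
    \<comment> \<open>The jump is a constant vector, so the integral of its square is the squared
      norm times the total surface measure.\<close>
    then have "(lam / diameter e) * ((norm ?j)\<^sup>2 * measure (surface_measure e) UNIV) = 0"
      using J[OF e] by (auto simp: J_def)
    moreover have "lam \<noteq> 0" "diameter e \<noteq> 0" "measure (surface_measure e) UNIV \<noteq> 0"
      using lam mesh_face(5)[OF e] surface_measure_pos[OF mesh_face(1-4)[OF e]] by linarith+
    ultimately show ?thesis by simp
  qed
  show ?thesis
    using const[OF K] jump_free_constants_vanish[OF jump0 K] by auto
qed

end

section \<open>Monotone equations in finite dimension\<close>

text \<open>Gaussian elimination, one equation at a time: either equation \<open>k\<close> is void,
  or it is solved for a pivot unknown \<open>p\<close> and the remaining equations have one unknown
  less.\<close>

lemma underdetermined_system: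
  fixes \<phi> :: "'i \<Rightarrow> 'j \<Rightarrow> real"
  assumes "finite J" "finite I" "card J < card I"
  shows "\<exists>c. (\<exists>i\<in>I. c i \<noteq> 0) \<and> (\<forall>j\<in>J. (\<Sum>i\<in>I. c i * \<phi> i j) = 0)"
  using assms
proof (induction J arbitrary: I \<phi> rule: finite_induct)
  case empty
  then have "I \<noteq> {}" by auto
  then show ?case by (intro exI[of _ "\<lambda>_. 1"]) auto
next
  case (insert k J)
  show ?case
  proof (cases "\<forall>i\<in>I. \<phi> i k = 0")
    case True
    obtain c where "\<exists>i\<in>I. c i \<noteq> 0" "\<forall>j\<in>J. (\<Sum>i\<in>I. c i * \<phi> i j) = 0"
      using insert.IH[of I \<phi>] insert.prems insert.hyps by auto
    then show ?thesis using True by (intro exI[of _ c]) auto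
  next
    case False
    then obtain p where p: "p \<in> I" "\<phi> p k \<noteq> 0" by blast
    \<comment> \<open>Substituting for the pivot unknown changes the other coefficients to
      \<open>\<psi>\<close>; those of equation \<open>k\<close> become zero.\<close>
    define \<psi> where "\<psi> i j = \<phi> i j - \<phi> i k / \<phi> p k * \<phi> p j" for i j
    have "card J < card (I - {p})"
      using insert.prems insert.hyps p by simp
    then obtain c where c: "\<exists>i\<in>I - {p}. c i \<noteq> 0" "\<forall>j\<in>J. (\<Sum>i\<in>I - {p}. c i * \<psi> i j) = 0"
      using insert.IH[of "I - {p}" \<psi>] insert.prems by auto
    \<comment> \<open>The value at \<open>p\<close> is the one that equation \<open>k\<close>
      dictates.\<close>
    define c' where "c' i = (if i = p then - (\<Sum>i\<in>I - {p}. c i * (\<phi> i k / \<phi> p k)) else c i)" for i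
    have sum: "(\<Sum>i\<in>I. c' i * \<phi> i j) = (\<Sum>i\<in>I - {p}. c i * \<psi> i j)" for j
    proof -
      have "(\<Sum>i\<in>I. c' i * \<phi> i j) = c' p * \<phi> p j + (\<Sum>i\<in>I - {p}. c' i * \<phi> i j)"
        using p insert.prems by (intro sum.remove) auto
      also have "(\<Sum>i\<in>I - {p}. c' i * \<phi> i j) = (\<Sum>i\<in>I - {p}. c i * \<phi> i j)"
        by (rule sum.cong) (auto simp: c'_def)
      also have "c' p * \<phi> p j = - (\<Sum>i\<in>I - {p}. c i * (\<phi> i k / \<phi> p k) * \<phi> p j)"
        by (simp add: c'_def sum_distrib_right)
      finally show ?thesis
        by (simp add: \<psi>_def right_diff_distrib sum_subtractf mult.assoc)
    qed
    have "\<psi> i k = 0" for i using p by (simp add: \<psi>_def)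
    then have "\<forall>j\<in>insert k J. (\<Sum>i\<in>I. c' i * \<phi> i j) = 0"
      using c(2) sum by auto
    moreover have "\<exists>i\<in>I. c' i \<noteq> 0" using c(1) by (auto simp: c'_def)
    ultimately show ?thesis by blast
  qed
qed

text \<open>In the squared distance of two damped images the cross term is nonpositive by
  \<open>mono\<close>. Only coordinates below \<open>n\<close> are controlled; by \<open>lip\<close>
  the values \<open>G x j\<close> with \<open>j < n\<close> depend on these alone, and convergence
  is shown coordinate by coordinate.\<close>

lemma monotone_lipschitz_fixed_point:
  fixes G :: "(nat \<Rightarrow> real) \<Rightarrow> nat \<Rightarrow> real"
  assumes L: "L \<ge> 0"
    and lip: "\<And>x y. (\<Sum>j<n. (G x j - G y j)\<^sup>2) \<le> L * (\<Sum>j<n. (x j - y j)\<^sup>2)"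
    and mono: "\<And>x y. (\<Sum>j<n. (x j - y j) * (G x j - G y j)) \<le> 0"
  shows "\<exists>x. \<forall>j<n. G x j = x j"
proof -
  \<comment> \<open>The minimizer of \<open>(1 - \<tau>)\<^sup>2 + \<tau>\<^sup>2 * L\<close>; the
    minimum is \<open>q\<close>. Here \<open>L\<close> bounds the square of the Lipschitz
    constant.\<close>
  define \<tau> where "\<tau> = 1 / (1 + L)"
  define q where "q = L / (1 + L)"
  define T where "T x j = (1 - \<tau>) * x j + \<tau> * G x j" for x j
  define D where "D x y = (\<Sum>j<n. (x j - y j)\<^sup>2)" for x y :: "nat \<Rightarrow> real"
  have \<tau>: "0 < \<tau>" "\<tau> \<le> 1" using L by (auto simp: \<tau>_def)
  have q: "0 \<le> q" "q < 1" using L by (auto simp: q_def)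
  have q_eq: "(1 - \<tau>)\<^sup>2 + \<tau>\<^sup>2 * L = q"
  proof -
    have a: "(1 + L) * \<tau> = 1" using L by (simp add: \<tau>_def)
    then have "1 - \<tau> = L * \<tau>" by (simp add: distrib_right)
    then have "(1 - \<tau>)\<^sup>2 + \<tau>\<^sup>2 * L = (L * \<tau>)\<^sup>2 + \<tau>\<^sup>2 * L" by simp
    also have "\<dots> = L * \<tau> * ((1 + L) * \<tau>)"
      by (simp add: power2_eq_square algebra_simps)
    finally show ?thesis unfolding a by (simp add: \<tau>_def q_def)
  qed
  have contr: "D (T x) (T y) \<le> q * D x y" for x y
  proof -
    have "D (T x) (T y) = (\<Sum>j<n. (1 - \<tau>)\<^sup>2 * (x j - y j)\<^sup>2
        + 2 * \<tau> * (1 - \<tau>) * ((x j - y j) * (G x j - G y j)) + \<tau>\<^sup>2 * (G x j - G y j)\<^sup>2)"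
      unfolding D_def T_def by (rule sum.cong) (auto simp: power2_eq_square algebra_simps)
    also have "\<dots> = (1 - \<tau>)\<^sup>2 * D x y
        + 2 * \<tau> * (1 - \<tau>) * (\<Sum>j<n. (x j - y j) * (G x j - G y j))
        + \<tau>\<^sup>2 * (\<Sum>j<n. (G x j - G y j)\<^sup>2)"
      by (simp add: D_def sum.distrib sum_distrib_left)
    also have "\<dots> \<le> (1 - \<tau>)\<^sup>2 * D x y + 0 + \<tau>\<^sup>2 * (L * D x y)"
      using \<tau> mono[of x y] lip[of x y]
      by (intro add_mono mult_left_mono mult_nonneg_nonpos) (auto simp: D_def)
    also have "\<dots> = q * D x y"
      using q_eq by (metis add.right_neutral distrib_right mult.assoc)
    finally show ?thesis .
  qed
  have D_coord: "(x j - y j)\<^sup>2 \<le> D x y" if "j < n" for x y j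
    unfolding D_def using that
    by (intro member_le_sum[of j "{..<n}" "\<lambda>j. (x j - y j)\<^sup>2"]) auto
  define X where "X k = (T ^^ k) (\<lambda>_. 0)" for k
  have X_Suc: "X (Suc k) = T (X k)" for k by (simp add: X_def)
  have D_X: "D (X (Suc k)) (X k) \<le> q ^ k * D (X 1) (X 0)" for k
  proof (induction k)
    case (Suc k)
    have "D (X (Suc (Suc k))) (X (Suc k)) \<le> q * D (X (Suc k)) (X k)"
      unfolding X_Suc[of "Suc k"] X_Suc[of k] by (metis X_Suc contr)
    also have "\<dots> \<le> q * (q ^ k * D (X 1) (X 0))"
      using Suc q by (intro mult_left_mono) auto
    finally show ?case by (simp add: mult.assoc)
  qed simp
  have "convergent (\<lambda>k. X k j)" if j: "j < n" for j
  proof -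
    \<comment> \<open>\<open>D\<close> is a squared distance, so the increments of a coordinate
      decay with ratio \<open>sqrt q\<close>.\<close>
    have "norm (X (Suc k) j - X k j) \<le> sqrt (D (X 1) (X 0)) * sqrt q ^ k" for k
    proof -
      have "(X (Suc k) j - X k j)\<^sup>2 \<le> q ^ k * D (X 1) (X 0)"
        using D_coord[OF j] D_X order_trans by blast
      then have "sqrt ((X (Suc k) j - X k j)\<^sup>2) \<le> sqrt (q ^ k * D (X 1) (X 0))"
        by (rule real_sqrt_le_mono)
      moreover have "sqrt ((X (Suc k) j - X k j)\<^sup>2) = norm (X (Suc k) j - X k j)"
        by (simp only: real_sqrt_abs real_norm_def)
      moreover have "sqrt (q ^ k * D (X 1) (X 0)) = sqrt (D (X 1) (X 0)) * sqrt q ^ k"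
        by (metis real_sqrt_mult real_sqrt_power mult.commute)
      ultimately show ?thesis by (simp only:)
    qed
    then have le: "norm (X (Suc k) j - X k j) \<le> sqrt (D (X 1) (X 0)) * sqrt q ^ k" if "k \<ge> 0" for k
      by blast
    have "summable (\<lambda>k. sqrt (D (X 1) (X 0)) * sqrt q ^ k)"
      using q by (intro summable_mult summable_geometric) auto
    then have "summable (\<lambda>k. X (Suc k) j - X k j)"
      using le by (rule summable_comparison_test')
    then have "convergent (\<lambda>m. \<Sum>k<m. X (Suc k) j - X k j)"
      by (simp add: summable_iff_convergent)
    then have "convergent (\<lambda>m. X m j - X 0 j)"
      by (simp only: sum_lessThan_telescope[of "\<lambda>k. X k j"])
    then have "convergent (\<lambda>m. (X m j - X 0 j) + X 0 j)"
      by (intro convergent_add convergent_const)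
    then show ?thesis by simp
  qed
  then obtain x where x: "\<And>j. j < n \<Longrightarrow> (\<lambda>k. X k j) \<longlonglongrightarrow> x j"
    unfolding convergent_def by metis
  have D0: "(\<lambda>k. D (X k) x) \<longlonglongrightarrow> 0"
  proof -
    have "(\<lambda>k. D (X k) x) \<longlonglongrightarrow> (\<Sum>j<n. (x j - x j)\<^sup>2)"
      unfolding D_def using x by (intro tendsto_sum tendsto_power tendsto_diff tendsto_const) auto
    then show ?thesis by simp
  qed
  have "G x j = x j" if j: "j < n" for j
  proof -
    \<comment> \<open>The contraction estimate takes the place of continuity of
      \<open>T\<close>.\<close>
    have "(\<lambda>k. (X (Suc k) j - T x j)\<^sup>2) \<longlonglongrightarrow> 0"
    proof (rule tendsto_sandwich[OF _ _ tendsto_const])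
      show "(\<lambda>k. q * D (X k) x) \<longlonglongrightarrow> 0"
        using tendsto_mult_left[OF D0, of q] by simp
      show "\<forall>\<^sub>F k in sequentially. (X (Suc k) j - T x j)\<^sup>2 \<le> q * D (X k) x"
        using D_coord[OF j] contr X_Suc order_trans by (metis (no_types, lifting) always_eventually)
    qed auto
    moreover have "(\<lambda>k. (X (Suc k) j - T x j)\<^sup>2) \<longlonglongrightarrow> (x j - T x j)\<^sup>2"
      using LIMSEQ_Suc[OF x[OF j]] by (intro tendsto_power tendsto_diff tendsto_const)
    ultimately have "(x j - T x j)\<^sup>2 = 0"
      using LIMSEQ_unique by blast
    then have "\<tau> * (x j - G x j) = 0" by (simp add: T_def algebra_simps)
    then show ?thesis using \<tau> by simp
  qed
  then show ?thesis by blast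
qed

section \<open>Orthonormal families for a positive semidefinite form\<close>

text \<open>Functions modulo the kernel of a positive semidefinite form; \<open>coords\<close> expresses that this
  quotient has dimension at most \<open>card J\<close>.\<close>

locale finite_dim_form =
  fixes V :: "('a \<Rightarrow> real) set" and B :: "('a \<Rightarrow> real) \<Rightarrow> ('a \<Rightarrow> real) \<Rightarrow> real"
    and J :: "'j set" and \<phi> :: "('a \<Rightarrow> real) \<Rightarrow> 'j \<Rightarrow> real"
  assumes zero: "(\<lambda>x. 0) \<in> V"
    and linear_combination: "\<And>v w a b. v \<in> V \<Longrightarrow> w \<in> V \<Longrightarrow> (\<lambda>x. a * v x + b * w x) \<in> V"
    and form_commute: "\<And>v w. v \<in> V \<Longrightarrow> w \<in> V \<Longrightarrow> B v w = B w v"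
    and form_linear: "\<And>v w u a b. v \<in> V \<Longrightarrow> w \<in> V \<Longrightarrow> u \<in> V \<Longrightarrow>
      B (\<lambda>x. a * v x + b * w x) u = a * B v u + b * B w u"
    and form_nonneg: "\<And>v. v \<in> V \<Longrightarrow> B v v \<ge> 0"
    and finite_coords: "finite J"
    and coords: "\<And>e c n. (\<And>i. i < n \<Longrightarrow> e i \<in> V) \<Longrightarrow>
      (\<And>j. j \<in> J \<Longrightarrow> (\<Sum>i<n. c i * \<phi> (e i) j) = 0) \<Longrightarrow>
      B (\<lambda>x. \<Sum>i<n::nat. c i * e i x) (\<lambda>x. \<Sum>i<n. c i * e i x) = 0"
begin

lemma sum_mem:
  assumes "\<And>i. i < n \<Longrightarrow> e i \<in> V"
  shows "(\<lambda>x. \<Sum>i<n::nat. c i * e i x) \<in> V"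
  using assms
proof (induction n)
  case (Suc n)
  then show ?case
    using linear_combination[of "\<lambda>x. \<Sum>i<n. c i * e i x" "e n" 1 "c n"] by simp
qed (simp add: zero)

lemma form_sum:
  assumes "\<And>i. i < n \<Longrightarrow> e i \<in> V" and u: "u \<in> V"
  shows "B (\<lambda>x. \<Sum>i<n::nat. c i * e i x) u = (\<Sum>i<n. c i * B (e i) u)"
  using assms(1)
proof (induction n)
  case 0
  show ?case using form_linear[OF zero zero u, of 0 0] by simp
next
  case (Suc n)
  then show ?case
    using form_linear[of "\<lambda>x. \<Sum>i<n. c i * e i x" "e n" u 1 "c n"] sum_mem[of n e c] u by simp
qed

definition orthonormal :: "(nat \<Rightarrow> 'a \<Rightarrow> real) \<Rightarrow> nat \<Rightarrow> bool" where
  "orthonormal e n \<longleftrightarrow> (\<forall>i<n. e i \<in> V \<and> (\<forall>j<n. B (e i) (e j) = (if i = j then 1 else 0)))"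

definition residual :: "(nat \<Rightarrow> 'a \<Rightarrow> real) \<Rightarrow> nat \<Rightarrow> ('a \<Rightarrow> real) \<Rightarrow> 'a \<Rightarrow> real" where
  "residual e n v = (\<lambda>x. v x - (\<Sum>i<n. B v (e i) * e i x))"

lemma residual_mem:
  assumes "orthonormal e n" "v \<in> V"
  shows "residual e n v \<in> V"
  using linear_combination[OF assms(2) sum_mem[of n e "\<lambda>i. B v (e i)"], of 1 "-1"] assms
  by (simp add: residual_def orthonormal_def)

lemma form_orthonormal_sum:
  assumes "orthonormal e n" "j < n"
  shows "B (\<lambda>x. \<Sum>i<n. c i * e i x) (e j) = c j"
proof -
  have "(\<Sum>i<n. c i * B (e i) (e j)) = (\<Sum>i<n. if i = j then c j else 0)"
    using assms by (intro sum.cong) (auto simp: orthonormal_def)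
  then show ?thesis
    using assms form_sum[of n e "e j" c] by (simp add: orthonormal_def)
qed

lemma form_residual:
  assumes "orthonormal e n" "v \<in> V" "j < n"
  shows "B (residual e n v) (e j) = 0"
  using form_linear[OF assms(2) sum_mem[of n e "\<lambda>i. B v (e i)"], of "e j" 1 "-1"] assms
    form_orthonormal_sum[OF assms(1,3), of "\<lambda>i. B v (e i)"]
  by (simp add: residual_def orthonormal_def)

text \<open>A longer family has a nontrivial combination with vanishing coordinates. Its form is
  zero by \<open>coords\<close>, but by orthonormality it is also the sum of the squared
  coefficients.\<close>

lemma orthonormal_bound:
  assumes "orthonormal e n"
  shows "n \<le> card J"
proof (rule ccontr)
  assume "\<not> n \<le> card J"
  then obtain c where c: "\<exists>i\<in>{..<n}. c i \<noteq> 0" "\<forall>j\<in>J. (\<Sum>i<n. c i * \<phi> (e i) j) = 0"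
    using underdetermined_system[of J "{..<n}" "\<lambda>i. \<phi> (e i)"] finite_coords
    by (metis card_lessThan finite_lessThan not_le)
  let ?s = "\<lambda>x. \<Sum>i<n. c i * e i x"
  have e: "\<And>i. i < n \<Longrightarrow> e i \<in> V" using assms by (simp add: orthonormal_def)
  have sV: "?s \<in> V" using sum_mem[OF e] .
  have "B ?s ?s = (\<Sum>i<n. c i * B (e i) ?s)" using form_sum[OF e sV] .
  also have "\<dots> = (\<Sum>i<n. c i * c i)"
  proof (rule sum.cong)
    fix i assume "i \<in> {..<n}"
    then have i: "i < n" by simp
    show "c i * B (e i) ?s = c i * c i"
      using form_commute[OF e[OF i] sV] form_orthonormal_sum[OF assms i, of c] by simp
  qed simp
  finally have "(\<Sum>i<n. c i * c i) = 0" using coords[of n e c] e c(2) by simp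
  then have "\<forall>i\<in>{..<n}. c i * c i = 0" by (subst (asm) sum_nonneg_eq_0_iff) simp_all
  then show False using c(1) by auto
qed

text \<open>One Gram-Schmidt step: the residual is orthogonal to the family and can be normalized
  because its form is positive.\<close>

lemma orthonormal_extend:
  assumes e: "orthonormal e n" and v: "v \<in> V" "B (residual e n v) (residual e n v) \<noteq> 0"
  shows "\<exists>e'. orthonormal e' (Suc n)"
proof -
  define q where "q = residual e n v"
  define s where "s = 1 / sqrt (B q q)"
  \<comment> \<open>The summand \<open>0 * q x\<close> gives the scaled residual the two-term shape
    in which closure of \<open>V\<close> and linearity of the form are stated.\<close>
  define w where "w = (\<lambda>x. s * q x + 0 * q x)"
  have q: "q \<in> V" "B q q > 0"
    using residual_mem[OF e v(1)] v(2) form_nonneg[of q] by (auto simp: q_def less_le)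
  have wV: "w \<in> V" unfolding w_def using linear_combination[OF q(1) q(1)] .
  have wB: "B w u = s * B q u" if "u \<in> V" for u
    unfolding w_def using form_linear[OF q(1) q(1) that, of s 0] by simp
  have "B w w = s * (s * B q q)"
    using wB[OF wV] wB[OF q(1)] form_commute[OF q(1) wV] by simp
  also have "\<dots> = 1"
    using q(2) by (simp add: s_def)
  finally have ww: "B w w = 1" .
  have we: "B w (e j) = 0" if "j < n" for j
    using wB[of "e j"] form_residual[OF e v(1) that] e that by (simp add: orthonormal_def q_def)
  have "orthonormal (e(n := w)) (Suc n)"
    unfolding orthonormal_def
  proof (intro allI impI)
    fix i assume i: "i < Suc n"
    have eV: "e i \<in> V" "\<And>j. j < n \<Longrightarrow> B (e i) (e j) = (if i = j then 1 else 0)" if "i < n" for i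
      using e that by (auto simp: orthonormal_def)
    have ew: "B (e i) w = 0" if "i < n" for i
      using form_commute[OF eV(1)[OF that] wV] we[OF that] by simp
    show "(e(n := w)) i \<in> V \<and>
        (\<forall>j<Suc n. B ((e(n := w)) i) ((e(n := w)) j) = (if i = j then 1 else 0))"
    proof (cases "i = n")
      case True
      then show ?thesis using wV ww we by simp
    next
      case False
      then have "i < n" using i by simp
      then show ?thesis using False eV[of i] ew[of i] by simp
    qed
  qed
  then show ?thesis by blast
qed

text \<open>A family of greatest length cannot be extended, so every residual has form zero, though
  it need not be the zero function.\<close>

lemma complete_orthonormal_family:
  "\<exists>e n. orthonormal e n \<and> (\<forall>v\<in>V. B (residual e n v) (residual e n v) = 0)"
proof -
  have "\<exists>e. orthonormal e 0" by (simp add: orthonormal_def)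
  then obtain n where n: "\<exists>e. orthonormal e n" "\<And>m. \<exists>e. orthonormal e m \<Longrightarrow> m \<le> n"
    using ex_has_greatest_nat[of "\<lambda>n. \<exists>e. orthonormal e n" 0 "\<lambda>n. n" "Suc (card J)"] orthonormal_bound
    by (metis le_imp_less_Suc)
  then obtain e where e: "orthonormal e n" by blast
  have "B (residual e n v) (residual e n v) = 0" if "v \<in> V" for v
    using orthonormal_extend[OF e that] n(2)[of "Suc n"] by auto
  with e show ?thesis by blast
qed

text \<open>In coordinates with respect to an orthonormal family, the variational equation is a fixed
  point problem \<open>x = G x\<close> with \<open>-G\<close> monotone and \<open>G\<close> Lipschitz continuous.\<close>

lemma monotone_variational_equation:
  assumes F_linear: "\<And>u v w a b. u \<in> V \<Longrightarrow> v \<in> V \<Longrightarrow> w \<in> V \<Longrightarrow>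
      F u (\<lambda>x. a * v x + b * w x) = a * F u v + b * F u w"
    and F_kernel: "\<And>u q. u \<in> V \<Longrightarrow> q \<in> V \<Longrightarrow> B q q = 0 \<Longrightarrow> F u q = 0"
    and F_monotone: "\<And>u w. u \<in> V \<Longrightarrow> w \<in> V \<Longrightarrow> F u (\<lambda>x. u x - w x) - F w (\<lambda>x. u x - w x) \<le> 0"
    and F_lipschitz: "\<And>e n v. (\<And>i. i < n \<Longrightarrow> e i \<in> V) \<Longrightarrow> v \<in> V \<Longrightarrow>
      \<exists>C\<ge>0. \<forall>x y. \<bar>F (\<lambda>z. \<Sum>i<n::nat. x i * e i z) v - F (\<lambda>z. \<Sum>i<n. y i * e i z) v\<bar>
        \<le> C * (\<Sum>i<n. \<bar>x i - y i\<bar>)"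
  shows "\<exists>u\<in>V. \<forall>v\<in>V. B u v = F u v"
proof -
  obtain e n where e: "orthonormal e n"
    and complete: "\<And>v. v \<in> V \<Longrightarrow> B (residual e n v) (residual e n v) = 0"
    using complete_orthonormal_family by (elim exE conjE) (rule that, auto)
  have eV: "\<And>i. i < n \<Longrightarrow> e i \<in> V" using e by (simp add: orthonormal_def)
  define U where "U x = (\<lambda>z. \<Sum>i<n. x i * e i z)" for x
  have UV: "U x \<in> V" for x unfolding U_def by (rule sum_mem[OF eV])
  have F_zero: "F u (\<lambda>x. 0) = 0" if "u \<in> V" for u
    using F_linear[OF that zero zero, of 0 0] by simp
  have F_sum: "F u (\<lambda>z. \<Sum>i<m. c i * e i z) = (\<Sum>i<m. c i * F u (e i))"
    if "u \<in> V" "m \<le> n" for u m c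
    using that(2)
  proof (induction m)
    case (Suc m)
    then show ?case
      using F_linear[OF that(1) sum_mem[of m e c], of "e m" 1 "c m"] eV by simp
  qed (simp add: F_zero that)
  define G where "G x j = F (U x) (e j)" for x j
  have "\<exists>C\<ge>0. \<forall>x y. \<bar>G x j - G y j\<bar> \<le> C * (\<Sum>i<n. \<bar>x i - y i\<bar>)" if "j < n" for j
    unfolding G_def U_def by (rule F_lipschitz[OF eV eV[OF that]])
  then obtain C where C: "\<And>j. j < n \<Longrightarrow> C j \<ge> 0"
    "\<And>j x y. j < n \<Longrightarrow> \<bar>G x j - G y j\<bar> \<le> C j * (\<Sum>i<n. \<bar>x i - y i\<bar>)"
    by metis
  \<comment> \<open>The bound by absolute values is turned into one by squares with Cauchy-Schwarz,
    at the price of the factor \<open>real n\<close>.\<close>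
  define L where "L = (\<Sum>j<n. (C j)\<^sup>2 * real n)"
  have "\<exists>x. \<forall>j<n. G x j = x j"
  proof (rule monotone_lipschitz_fixed_point)
    show "L \<ge> 0" by (simp add: L_def sum_nonneg)
    fix x y
    have CS: "(\<Sum>i<n. \<bar>x i - y i\<bar>)\<^sup>2 \<le> real n * (\<Sum>i<n. (x i - y i)\<^sup>2)"
      using Cauchy_Schwarz_ineq_sum[of "\<lambda>_. 1" "\<lambda>i. \<bar>x i - y i\<bar>" "{..<n}"] by simp
    have "(G x j - G y j)\<^sup>2 \<le> ((C j)\<^sup>2 * real n) * (\<Sum>i<n. (x i - y i)\<^sup>2)" if j: "j < n" for j
    proof -
      have "(G x j - G y j)\<^sup>2 \<le> (C j * (\<Sum>i<n. \<bar>x i - y i\<bar>))\<^sup>2"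
        using power_mono[OF C(2)[OF j, of x y], of 2] by simp
      also have "\<dots> = (C j)\<^sup>2 * (\<Sum>i<n. \<bar>x i - y i\<bar>)\<^sup>2" by (simp add: power_mult_distrib)
      also have "\<dots> \<le> (C j)\<^sup>2 * (real n * (\<Sum>i<n. (x i - y i)\<^sup>2))"
        using CS by (intro mult_left_mono) auto
      finally show ?thesis by (simp add: mult.assoc)
    qed
    then show "(\<Sum>j<n. (G x j - G y j)\<^sup>2) \<le> L * (\<Sum>i<n. (x i - y i)\<^sup>2)"
      unfolding L_def sum_distrib_right by (intro sum_mono) auto
    have diff: "(\<lambda>z. U x z - U y z) = (\<lambda>z. \<Sum>i<n. (x i - y i) * e i z)"
      by (auto simp: U_def left_diff_distrib sum_subtractf)
    have "F (U x) (\<lambda>z. U x z - U y z) - F (U y) (\<lambda>z. U x z - U y z)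
        = (\<Sum>j<n. (x j - y j) * G x j) - (\<Sum>j<n. (x j - y j) * G y j)"
      unfolding diff using F_sum[OF UV[of x] order_refl, of "\<lambda>i. x i - y i"]
        F_sum[OF UV[of y] order_refl, of "\<lambda>i. x i - y i"] by (simp only: G_def)
    then show "(\<Sum>j<n. (x j - y j) * (G x j - G y j)) \<le> 0"
      using F_monotone[OF UV UV, of x y] by (simp add: right_diff_distrib sum_subtractf)
  qed
  then obtain x where x: "\<And>j. j < n \<Longrightarrow> G x j = x j" by blast
  have "B (U x) v = F (U x) v" if v: "v \<in> V" for v
  proof -
    let ?q = "residual e n v" and ?s = "\<lambda>z. \<Sum>i<n. B v (e i) * e i z"
    have qV: "?q \<in> V" by (rule residual_mem[OF e v])
    have sV: "?s \<in> V" by (rule sum_mem[OF eV])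
    \<comment> \<open>For \<open>F\<close> the test function is split into its residual, which
      \<open>F_kernel\<close> removes, and its projection, on which the fixed point equations
      apply.\<close>
    have split: "v = (\<lambda>z. 1 * ?q z + 1 * ?s z)" by (simp add: residual_def)
    have "F (U x) v = 1 * F (U x) ?q + 1 * F (U x) ?s"
      by (subst split, rule F_linear[OF UV qV sV])
    also have "F (U x) ?q = 0"
      using complete[OF v] by (intro F_kernel UV qV)
    also have "F (U x) ?s = (\<Sum>j<n. B v (e j) * x j)"
      using F_sum[OF UV[of x] order_refl, of "\<lambda>i. B v (e i)"] x by (simp add: G_def)
    finally have 1: "F (U x) v = (\<Sum>j<n. B v (e j) * x j)" by simp
    have "B (U x) v = (\<Sum>j<n. x j * B (e j) v)"
      unfolding U_def by (rule form_sum[OF eV v])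
    also have "\<dots> = (\<Sum>j<n. B v (e j) * x j)"
      using form_commute[OF v eV] by (intro sum.cong) auto
    finally show ?thesis using 1 by simp
  qed
  then show ?thesis using UV by blast
qed

end

section \<open>Square-integrable functions and the nonlinearity\<close>

lemma L2_linear_combination:
  assumes "v \<in> L2 \<Omega>" "w \<in> L2 \<Omega>"
  shows "(\<lambda>x. a * v x + b * w x) \<in> L2 \<Omega>"
proof -
  have m: "v \<in> borel_measurable (lebesgue_on \<Omega>)" "w \<in> borel_measurable (lebesgue_on \<Omega>)"
    and i: "integrable (lebesgue_on \<Omega>) (\<lambda>x. (v x)\<^sup>2)" "integrable (lebesgue_on \<Omega>) (\<lambda>x. (w x)\<^sup>2)"
    using assms by (auto simp: L2_def)
  have "integrable (lebesgue_on \<Omega>) (\<lambda>x. (a * v x + b * w x)\<^sup>2)"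
  proof (rule Bochner_Integration.integrable_bound)
    show "integrable (lebesgue_on \<Omega>) (\<lambda>x. 2 * a\<^sup>2 * (v x)\<^sup>2 + 2 * b\<^sup>2 * (w x)\<^sup>2)"
      using i by simp
    show "(\<lambda>x. (a * v x + b * w x)\<^sup>2) \<in> borel_measurable (lebesgue_on \<Omega>)"
      using m by measurable
    have "(a * v x + b * w x)\<^sup>2 \<le> 2 * a\<^sup>2 * (v x)\<^sup>2 + 2 * b\<^sup>2 * (w x)\<^sup>2" for x
      using sum_squares_bound[of "a * v x" "b * w x"]
      by (simp add: power2_sum power_mult_distrib mult.assoc)
    then show "AE x in lebesgue_on \<Omega>. norm ((a * v x + b * w x)\<^sup>2)
        \<le> norm (2 * a\<^sup>2 * (v x)\<^sup>2 + 2 * b\<^sup>2 * (w x)\<^sup>2)"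
      by (intro AE_I2) (simp add: abs_of_nonneg)
  qed
  moreover have "(\<lambda>x. a * v x + b * w x) \<in> borel_measurable (lebesgue_on \<Omega>)"
    using m by measurable
  ultimately show ?thesis by (simp add: L2_def)
qed

lemma L2_zero: "(\<lambda>x. 0) \<in> L2 \<Omega>"
  by (simp add: L2_def)

lemma L2_sum:
  assumes "finite I" "\<And>i. i \<in> I \<Longrightarrow> g i \<in> L2 \<Omega>"
  shows "(\<lambda>x. \<Sum>i\<in>I. g i x) \<in> L2 \<Omega>"
  using assms
proof (induction I rule: finite_induct)
  case (insert i I)
  then show ?case
    using L2_linear_combination[of "g i" \<Omega> "\<lambda>x. \<Sum>i\<in>I. g i x" 1 1] by simp
qed (simp add: L2_zero)

lemma L2_cong_AE:
  assumes "v \<in> L2 \<Omega>" "w \<in> borel_measurable (lebesgue_on \<Omega>)" "AE x in lebesgue_on \<Omega>. v x = w x"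
  shows "w \<in> L2 \<Omega>"
proof -
  have v: "v \<in> borel_measurable (lebesgue_on \<Omega>)" "integrable (lebesgue_on \<Omega>) (\<lambda>x. (v x)\<^sup>2)"
    using assms by (auto simp: L2_def)
  have ae: "AE x in lebesgue_on \<Omega>. (v x)\<^sup>2 = (w x)\<^sup>2"
    using assms(3) by eventually_elim simp
  have "integrable (lebesgue_on \<Omega>) (\<lambda>x. (w x)\<^sup>2)"
    by (rule integrable_cong_AE_imp[OF v(2) _ ae]) (use assms(2) in measurable)
  then show ?thesis using assms by (simp add: L2_def)
qed

lemma L2_abs:
  assumes "v \<in> L2 \<Omega>"
  shows "(\<lambda>x. \<bar>v x\<bar>) \<in> L2 \<Omega>"
  using assms by (auto simp: L2_def)

lemma L2_bounded_by:
  assumes g: "g \<in> L2 \<Omega>" and w: "w \<in> borel_measurable (lebesgue_on \<Omega>)"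
    and le: "\<And>x. x \<in> \<Omega> \<Longrightarrow> \<bar>w x\<bar> \<le> g x"
  shows "w \<in> L2 \<Omega>"
proof -
  have "integrable (lebesgue_on \<Omega>) (\<lambda>x. (w x)\<^sup>2)"
  proof (rule Bochner_Integration.integrable_bound)
    show "integrable (lebesgue_on \<Omega>) (\<lambda>x. (g x)\<^sup>2)" using g by (simp add: L2_def)
    show "(\<lambda>x. (w x)\<^sup>2) \<in> borel_measurable (lebesgue_on \<Omega>)" using w by measurable
    have "(w x)\<^sup>2 \<le> (g x)\<^sup>2" if "x \<in> \<Omega>" for x
      using power_mono[OF le[OF that], of 2] by simp
    then show "AE x in lebesgue_on \<Omega>. norm ((w x)\<^sup>2) \<le> norm ((g x)\<^sup>2)"
      by (intro AE_I2) simp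
  qed
  then show ?thesis using w by (simp add: L2_def)
qed

lemma integrable_L2_mult:
  assumes "v \<in> L2 \<Omega>" "w \<in> L2 \<Omega>"
  shows "integrable (lebesgue_on \<Omega>) (\<lambda>x. v x * w x)"
proof (rule Bochner_Integration.integrable_bound)
  show "integrable (lebesgue_on \<Omega>) (\<lambda>x. (v x)\<^sup>2 + (w x)\<^sup>2)"
    using assms by (simp add: L2_def)
  show "(\<lambda>x. v x * w x) \<in> borel_measurable (lebesgue_on \<Omega>)"
    using assms by (auto simp: L2_def intro: borel_measurable_times)
  have "\<bar>v x * w x\<bar> \<le> (v x)\<^sup>2 + (w x)\<^sup>2" for x
  proof -
    have "2 * \<bar>v x\<bar> * \<bar>w x\<bar> \<le> (v x)\<^sup>2 + (w x)\<^sup>2"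
      using sum_squares_bound[of "\<bar>v x\<bar>" "\<bar>w x\<bar>"] by simp
    moreover have "0 \<le> \<bar>v x\<bar> * \<bar>w x\<bar>" by simp
    ultimately show ?thesis unfolding abs_mult by linarith
  qed
  then show "AE x in lebesgue_on \<Omega>. norm (v x * w x) \<le> norm ((v x)\<^sup>2 + (w x)\<^sup>2)"
    by (intro AE_I2) simp
qed

section \<open>Composition of a function with the nonlinearity\<close>

lemma borel_measurable_Caratheodory:
  fixes f :: "'a \<Rightarrow> real \<Rightarrow> real"
  assumes f: "\<And>s. (\<lambda>x. f x s) \<in> borel_measurable M"
    and cont: "\<And>x. x \<in> space M \<Longrightarrow> continuous_on UNIV (f x)"
    and w[measurable]: "w \<in> borel_measurable M"
  shows "(\<lambda>x. f x (w x)) \<in> borel_measurable M"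
proof (rule borel_measurable_LIMSEQ_real)
  \<comment> \<open>Rounding \<open>w\<close> down to multiples of \<open>1 / real (Suc n)\<close>
    gives countably many values, for each of which \<open>f\<close> is measurable in
    \<open>x\<close>. Continuity in the second argument then permits the pointwise limit.\<close>
  define a where "a n x = real_of_int \<lfloor>real (Suc n) * w x\<rfloor> / real (Suc n)" for n x
  show "(\<lambda>x. f x (a n x)) \<in> borel_measurable M" for n
    unfolding a_def
  proof (rule measurable_compose_countable[where f = "\<lambda>k x. f x (real_of_int k / real (Suc n))"
        and g = "\<lambda>x. \<lfloor>real (Suc n) * w x\<rfloor>"])
    show "(\<lambda>x. \<lfloor>real (Suc n) * w x\<rfloor>) \<in> measurable M (count_space UNIV)" by measurable
  qed (rule f)
  fix x assume x: "x \<in> space M"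
  have "(\<lambda>n. a n x) \<longlonglongrightarrow> w x"
  proof (rule LIMSEQ_I)
    fix e :: real assume "e > 0"
    then obtain N where N: "inverse (real (Suc N)) < e" using reals_Archimedean by blast
    have "norm (a n x - w x) < e" if "n \<ge> N" for n
    proof -
      have "a n x - w x = (real_of_int \<lfloor>real (Suc n) * w x\<rfloor> - real (Suc n) * w x) / real (Suc n)"
        unfolding a_def by (simp add: field_simps)
      moreover have "\<bar>real_of_int \<lfloor>real (Suc n) * w x\<rfloor> - real (Suc n) * w x\<bar> \<le> 1"
        by linarith
      ultimately have "norm (a n x - w x) \<le> 1 / real (Suc n)"
        by (simp only: real_norm_def abs_divide abs_of_nat) (rule divide_right_mono, auto)
      also have "\<dots> \<le> inverse (real (Suc N))"
        using that by (simp add: field_simps)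
      finally show ?thesis using N by linarith
    qed
    then show "\<exists>N. \<forall>n\<ge>N. norm (a n x - w x) < e" by blast
  qed
  moreover have "isCont (f x) (w x)"
    using cont[OF x] by (simp add: continuous_on_eq_continuous_at)
  ultimately show "(\<lambda>n. f x (a n x)) \<longlonglongrightarrow> f x (w x)"
    by (rule isCont_tendsto_compose[rotated])
qed

text \<open>The derivative bounds enter as monotonicity and a Lipschitz constant. \<open>u\<close>
  is only a reference function at which the nonlinearity is known to be square integrable.\<close>

locale monotone_nonlinearity =
  fixes \<Omega> :: "(real^'d) set" and f :: "real^'d \<Rightarrow> real \<Rightarrow> real" and M :: real and u :: "real^'d \<Rightarrow> real"
  assumes f_measurable: "\<And>s. (\<lambda>x. f x s) \<in> borel_measurable (lebesgue_on \<Omega>)"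
    and f_antimono: "\<And>x s t. x \<in> \<Omega> \<Longrightarrow> s \<le> t \<Longrightarrow> f x t \<le> f x s"
    and f_lipschitz: "\<And>x s t. x \<in> \<Omega> \<Longrightarrow> \<bar>f x s - f x t\<bar> \<le> M * \<bar>s - t\<bar>"
    and M_nonneg: "M \<ge> 0"
    and u_L2: "u \<in> L2 \<Omega>"
    and f_u_L2: "(\<lambda>x. f x (u x)) \<in> L2 \<Omega>"
begin

lemma f_L2:
  assumes w: "w \<in> L2 \<Omega>"
  shows "(\<lambda>x. f x (w x)) \<in> L2 \<Omega>"
proof (rule L2_bounded_by)
  \<comment> \<open>The majorant is the value at \<open>u\<close> plus the Lipschitz bound for the
    step to \<open>w\<close>; the factors 1 and -1 match
    \<open>L2_linear_combination\<close>.\<close>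
  show "(\<lambda>x. 1 * \<bar>f x (u x)\<bar> + M * \<bar>1 * w x + (- 1) * u x\<bar>) \<in> L2 \<Omega>"
    by (intro L2_linear_combination L2_abs f_u_L2 w u_L2)
  show "(\<lambda>x. f x (w x)) \<in> borel_measurable (lebesgue_on \<Omega>)"
  proof (rule borel_measurable_Caratheodory[OF f_measurable])
    show "w \<in> borel_measurable (lebesgue_on \<Omega>)" using w by (simp add: L2_def)
    fix x assume "x \<in> space (lebesgue_on \<Omega>)"
    then have x: "x \<in> \<Omega>" by simp
    have "M-lipschitz_on UNIV (f x)"
      using f_lipschitz[OF x] M_nonneg by (intro lipschitz_onI) (auto simp: dist_real_def)
    then show "continuous_on UNIV (f x)" by (rule lipschitz_on_continuous_on)
  qed
  show "\<bar>f x (w x)\<bar> \<le> 1 * \<bar>f x (u x)\<bar> + M * \<bar>1 * w x + (- 1) * u x\<bar>" if "x \<in> \<Omega>" for x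
    using f_lipschitz[OF that, of "w x" "u x"] by simp
qed

lemma integrable_f_mult:
  assumes "w \<in> L2 \<Omega>" "v \<in> L2 \<Omega>"
  shows "integrable (lebesgue_on \<Omega>) (\<lambda>x. f x (w x) * v x)"
  by (rule integrable_L2_mult[OF f_L2[OF assms(1)] assms(2)])

lemma f_integral_linear:
  assumes "w \<in> L2 \<Omega>" "v \<in> L2 \<Omega>" "v' \<in> L2 \<Omega>"
  shows "(LINT x|lebesgue_on \<Omega>. f x (w x) * (a * v x + b * v' x))
    = a * (LINT x|lebesgue_on \<Omega>. f x (w x) * v x) + b * (LINT x|lebesgue_on \<Omega>. f x (w x) * v' x)"
proof -
  have "(LINT x|lebesgue_on \<Omega>. f x (w x) * (a * v x + b * v' x))
      = (LINT x|lebesgue_on \<Omega>. a * (f x (w x) * v x) + b * (f x (w x) * v' x))"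
    by (rule arg_cong[of _ _ "integral\<^sup>L (lebesgue_on \<Omega>)"]) (simp add: algebra_simps)
  also have "\<dots> = a * (LINT x|lebesgue_on \<Omega>. f x (w x) * v x) + b * (LINT x|lebesgue_on \<Omega>. f x (w x) * v' x)"
    using integrable_f_mult[OF assms(1,2)] integrable_f_mult[OF assms(1,3)] by simp
  finally show ?thesis .
qed

lemma f_integral_monotone:
  assumes "v \<in> L2 \<Omega>" "w \<in> L2 \<Omega>" "d \<in> L2 \<Omega>" and d: "d = (\<lambda>x. v x - w x)"
  shows "(LINT x|lebesgue_on \<Omega>. f x (v x) * d x) - (LINT x|lebesgue_on \<Omega>. f x (w x) * d x) \<le> 0"
proof -
  have "(LINT x|lebesgue_on \<Omega>. f x (v x) * d x) - (LINT x|lebesgue_on \<Omega>. f x (w x) * d x)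
      = (LINT x|lebesgue_on \<Omega>. f x (v x) * d x - f x (w x) * d x)"
    using integrable_f_mult[OF assms(1,3)] integrable_f_mult[OF assms(2,3)] by simp
  also have "\<dots> \<le> (LINT x|lebesgue_on \<Omega>. 0)"
  proof (rule integral_mono)
    show "integrable (lebesgue_on \<Omega>) (\<lambda>x. f x (v x) * d x - f x (w x) * d x)"
      using integrable_f_mult[OF assms(1,3)] integrable_f_mult[OF assms(2,3)] by simp
    fix x assume "x \<in> space (lebesgue_on \<Omega>)"
    then have x: "x \<in> \<Omega>" by simp
    have "(f x (v x) - f x (w x)) * (v x - w x) \<le> 0"
      using f_antimono[OF x, of "v x" "w x"] f_antimono[OF x, of "w x" "v x"]
      by (cases "v x \<le> w x") (auto simp: mult_nonneg_nonpos mult_nonpos_nonneg)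
    then show "f x (v x) * d x - f x (w x) * d x \<le> 0"
      by (simp add: d left_diff_distrib)
  qed simp
  finally show ?thesis by simp
qed

text \<open>The Lipschitz bound and the triangle inequality hold pointwise. Integration leaves the
  constant \<open>M\<close> times the sum of the \<open>N i\<close>, which are integrals of products
  of \<open>L2\<close> functions.\<close>

lemma f_integral_lipschitz:
  assumes e: "\<And>i. i < n \<Longrightarrow> e i \<in> L2 \<Omega>" and v: "v \<in> L2 \<Omega>"
  shows "\<exists>C\<ge>0. \<forall>a b. \<bar>(LINT z|lebesgue_on \<Omega>. f z (\<Sum>i<n::nat. a i * e i z) * v z)
      - (LINT z|lebesgue_on \<Omega>. f z (\<Sum>i<n. b i * e i z) * v z)\<bar> \<le> C * (\<Sum>i<n. \<bar>a i - b i\<bar>)"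
proof -
  define N where "N i = (LINT z|lebesgue_on \<Omega>. \<bar>e i z\<bar> * \<bar>v z\<bar>)" for i
  have N: "N i \<ge> 0" for i by (simp add: N_def)
  have int: "integrable (lebesgue_on \<Omega>) (\<lambda>z. \<bar>e i z\<bar> * \<bar>v z\<bar>)" if "i < n" for i
    by (rule integrable_L2_mult[OF L2_abs[OF e[OF that]] L2_abs[OF v]])
  have sumL2: "(\<lambda>z. \<Sum>i<n. a i * e i z) \<in> L2 \<Omega>" for a
  proof (rule L2_sum)
    fix i assume "i \<in> {..<n}"
    then have "e i \<in> L2 \<Omega>" using e by simp
    then show "(\<lambda>z. a i * e i z) \<in> L2 \<Omega>"
      using L2_linear_combination[of "e i" \<Omega> "\<lambda>x. 0" "a i" 0] by (simp add: L2_zero)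
  qed simp
  have "\<bar>(LINT z|lebesgue_on \<Omega>. f z (\<Sum>i<n. a i * e i z) * v z)
      - (LINT z|lebesgue_on \<Omega>. f z (\<Sum>i<n. b i * e i z) * v z)\<bar>
      \<le> (M * (\<Sum>i<n. N i)) * (\<Sum>i<n. \<bar>a i - b i\<bar>)" for a b
  proof -
    define s t where "s z = (\<Sum>i<n. a i * e i z)" and "t z = (\<Sum>i<n. b i * e i z)" for z
    have st: "s \<in> L2 \<Omega>" "t \<in> L2 \<Omega>" unfolding s_def t_def by (rule sumL2)+
    note i = integrable_f_mult[OF st(1) v] integrable_f_mult[OF st(2) v]
    have i2: "integrable (lebesgue_on \<Omega>) (\<lambda>z. \<Sum>i<n. (M * \<bar>a i - b i\<bar>) * (\<bar>e i z\<bar> * \<bar>v z\<bar>))"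
      using int by (intro Bochner_Integration.integrable_sum) auto
    have "\<bar>(LINT z|lebesgue_on \<Omega>. f z (s z) * v z) - (LINT z|lebesgue_on \<Omega>. f z (t z) * v z)\<bar>
        = \<bar>(LINT z|lebesgue_on \<Omega>. f z (s z) * v z - f z (t z) * v z)\<bar>"
      using i by simp
    also have "\<dots> \<le> (LINT z|lebesgue_on \<Omega>. abs (f z (s z) * v z - f z (t z) * v z))"
      by (rule integral_abs_bound)
    also have "\<dots> \<le> (LINT z|lebesgue_on \<Omega>. (\<Sum>i<n. (M * \<bar>a i - b i\<bar>) * (\<bar>e i z\<bar> * \<bar>v z\<bar>)))"
    proof (rule integral_mono[OF _ i2])
      show "integrable (lebesgue_on \<Omega>) (\<lambda>z. \<bar>f z (s z) * v z - f z (t z) * v z\<bar>)"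
        using i by simp
      fix z assume "z \<in> space (lebesgue_on \<Omega>)"
      then have z: "z \<in> \<Omega>" by simp
      have "\<bar>f z (s z) - f z (t z)\<bar> \<le> M * \<bar>s z - t z\<bar>" by (rule f_lipschitz[OF z])
      also have "\<bar>s z - t z\<bar> = \<bar>\<Sum>i<n. (a i - b i) * e i z\<bar>"
        by (simp add: s_def t_def sum_subtractf left_diff_distrib)
      also have "M * \<dots> \<le> M * (\<Sum>i<n. \<bar>(a i - b i) * e i z\<bar>)"
        using M_nonneg by (intro mult_left_mono sum_abs)
      finally have "\<bar>f z (s z) - f z (t z)\<bar> * \<bar>v z\<bar> \<le> M * (\<Sum>i<n. \<bar>(a i - b i) * e i z\<bar>) * \<bar>v z\<bar>"
        by (rule mult_right_mono) simp
      also have "\<dots> = (\<Sum>i<n. (M * \<bar>a i - b i\<bar>) * (\<bar>e i z\<bar> * \<bar>v z\<bar>))"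
        by (simp add: sum_distrib_left sum_distrib_right abs_mult mult.assoc)
      finally show "\<bar>f z (s z) * v z - f z (t z) * v z\<bar>
          \<le> (\<Sum>i<n. (M * \<bar>a i - b i\<bar>) * (\<bar>e i z\<bar> * \<bar>v z\<bar>))"
        by (simp add: left_diff_distrib[symmetric] abs_mult)
    qed
    also have "\<dots> = (\<Sum>i<n. (M * \<bar>a i - b i\<bar>) * N i)"
      using int by (subst Bochner_Integration.integral_sum) (auto simp: N_def)
    also have "\<dots> \<le> (\<Sum>i<n. (M * \<bar>a i - b i\<bar>) * (\<Sum>j<n. N j))"
      using M_nonneg N by (intro sum_mono mult_left_mono member_le_sum) auto
    also have "\<dots> = (M * (\<Sum>i<n. N i)) * (\<Sum>i<n. \<bar>a i - b i\<bar>)"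
      unfolding sum_distrib_left by (rule sum.cong) (simp_all only: mult_ac sum_distrib_left)
    finally show ?thesis by (simp add: s_def t_def)
  qed
  moreover have "M * (\<Sum>i<n. N i) \<ge> 0"
    using M_nonneg N by (simp add: sum_nonneg)
  ultimately show ?thesis by blast
qed

end

section \<open>The discrete space\<close>

context simplicial_mesh
begin

lemma DG_space_L2: "v \<in> DG_space \<Omega> \<T> r \<Longrightarrow> v \<in> L2 \<Omega>"
  by (simp add: DG_space_def)

lemma DG_space_piecewise_polynomial:
  assumes "v \<in> DG_space \<Omega> \<T> r"
  shows "piecewise_polynomial \<T> v"
  unfolding piecewise_polynomial_def
proof
  fix K assume "K \<in> \<T>"
  then obtain p where "p \<in> polys r" "AE x in lebesgue_on K. v x = p x"
    using assms by (auto simp: DG_space_def)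
  then show "\<exists>p. real_polynomial_function p \<and> (AE x in lebesgue_on K. v x = p x)"
    using polys_real_polynomial_function by blast
qed

lemma piece_polys:
  assumes "v \<in> DG_space \<Omega> \<T> r" "K \<in> \<T>"
  shows "piece v K \<in> polys r"
proof -
  obtain p where p: "p \<in> polys r" "AE x in lebesgue_on K. v x = p x"
    using assms by (auto simp: DG_space_def)
  then show ?thesis
    using piece_eqI[OF polys_real_polynomial_function[OF p(1)] element(5,6)[OF assms(2)] p(2)] by simp
qed

lemma piece_zero_if_AE:
  assumes "K \<in> \<T>" "AE x in lebesgue_on K. v x = 0"
  shows "piece v K = (\<lambda>x. 0)"
  using piece_eqI[OF real_polynomial_function.intros(2) element(5,6)[OF assms(1)] assms(2)] .

lemma polys_zero: "(\<lambda>x. 0) \<in> polys r"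
  unfolding polys_def by (intro CollectI exI[of _ "\<lambda>_. 0"]) simp

lemma zero_in_DG_space: "(\<lambda>x. 0) \<in> DG_space \<Omega> \<T> r"
proof -
  have "piece (\<lambda>x. 0) K = (\<lambda>x. 0)" if "K \<in> \<T>" for K
    using piece_zero_if_AE[OF that] by simp
  then show ?thesis
    unfolding DG_space_def by (auto simp: L2_zero adjacent_def intro!: bexI[OF _ polys_zero])
qed

lemma DG_space_linear_combination:
  assumes v: "v \<in> DG_space \<Omega> \<T> r" and w: "w \<in> DG_space \<Omega> \<T> r"
  shows "(\<lambda>x. a * v x + b * w x) \<in> DG_space \<Omega> \<T> r"
  unfolding DG_space_def
proof (intro CollectI conjI ballI impI)
  note pp = DG_space_piecewise_polynomial[OF v] DG_space_piecewise_polynomial[OF w]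
  show "(\<lambda>x. a * v x + b * w x) \<in> L2 \<Omega>"
    using v w by (intro L2_linear_combination DG_space_L2)
  show "\<exists>p\<in>polys r. AE x in lebesgue_on K. a * v x + b * w x = p x" if K: "K \<in> \<T>" for K
  proof
    show "(\<lambda>x. a * piece v K x + b * piece w K x) \<in> polys r"
      using v w K by (intro polys_linear_combination piece_polys)
    show "AE x in lebesgue_on K. a * v x + b * w x = a * piece v K x + b * piece w K x"
      using piece(2)[OF pp(1) K] piece(2)[OF pp(2) K] by eventually_elim simp
  qed
  fix e K x assume e: "e \<in> mesh_faces \<T>" "e \<subseteq> frontier \<Omega>" "K \<in> adjacent \<T> e" "x \<in> e"
  then have "piece v K x = 0" "piece w K x = 0" "K \<in> \<T>"
    using v w by (auto simp: DG_space_def adjacent_def)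
  then show "piece (\<lambda>x. a * v x + b * w x) K x = 0"
    by (simp add: piece_linear_combination[OF pp])
qed

text \<open>The form sees \<open>w\<close> only through its pieces, so values on null sets are
  invisible to it.\<close>

lemma DG_form_zero:
  assumes "\<And>K. K \<in> \<T> \<Longrightarrow> piece w K = (\<lambda>x. 0)"
  shows "DG_form \<T> lam w v = 0"
proof -
  have g0: "gradient (\<lambda>x :: real^'d. 0) = (\<lambda>x. 0)"
    by (simp add: gradient_def vec_eq_iff fun_eq_iff)
  then have g: "gradient (piece w K) x = 0" if "K \<in> \<T>" for K x
    using assms[OF that] by simp
  have "jump \<T> e w x = 0" "avg_gradient \<T> e w x = 0" for e x
    unfolding jump_def avg_gradient_def using assms g0
    by (simp_all add: adjacent_def)
  then show ?thesis using g by (simp add: DG_form_def)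
qed

lemma AE_domain:
  assumes \<Omega>: "\<Omega> \<subseteq> \<Union>\<T>" "\<Omega> \<in> sets lebesgue"
    and ae: "\<And>K. K \<in> \<T> \<Longrightarrow> AE x in lebesgue_on K. P x"
  shows "AE x in lebesgue_on \<Omega>. P x"
proof -
  have "AE x in lebesgue. x \<in> K \<longrightarrow> P x" if "K \<in> \<T>" for K
    using ae[OF that] element(6)[OF that] by (simp add: AE_restrict_space_iff)
  then have "AE x in lebesgue. \<forall>K\<in>\<T>. x \<in> K \<longrightarrow> P x"
    by (intro AE_finite_allI finite_mesh)
  then have "AE x in lebesgue. x \<in> \<Omega> \<longrightarrow> P x"
    by eventually_elim (use \<Omega>(1) in blast)
  then show ?thesis using \<Omega> by (simp add: AE_restrict_space_iff)
qed

section \<open>Finite dimension of the discrete space\<close>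

text \<open>Monomial coefficients of the pieces. Any choice that represents the pieces will do, even
  one that is not linear in \<open>v\<close>: a combination with vanishing coordinates then has
  vanishing pieces.\<close>

definition coordinates :: "nat \<Rightarrow> (real^'d \<Rightarrow> real) \<Rightarrow> (real^'d) set \<times> ('d \<Rightarrow> nat) \<Rightarrow> real" where
  "coordinates r v = (\<lambda>(K, \<alpha>). (SOME c. \<forall>x. piece v K x =
     (\<Sum>\<alpha> | (\<Sum>i\<in>UNIV. \<alpha> i) \<le> r. c \<alpha> * (\<Prod>i\<in>UNIV. (x $ i) ^ \<alpha> i))) \<alpha>)"

lemma piece_coordinates:
  assumes "v \<in> DG_space \<Omega> \<T> r" "K \<in> \<T>"
  shows "piece v K x =
    (\<Sum>\<alpha> | (\<Sum>i\<in>UNIV. \<alpha> i) \<le> r. coordinates r v (K, \<alpha>) * (\<Prod>i\<in>UNIV. (x $ i) ^ \<alpha> i))"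
proof -
  have "\<exists>c. \<forall>x. piece v K x =
      (\<Sum>\<alpha> | (\<Sum>i\<in>UNIV. \<alpha> i) \<le> r. c \<alpha> * (\<Prod>i\<in>UNIV. (x $ i) ^ \<alpha> i))"
    using piece_polys[OF assms] by (simp add: polys_def)
  from someI_ex[OF this] show ?thesis
    unfolding coordinates_def prod.case by (rule spec)
qed

lemma DG_form_zero_if_coordinates:
  assumes e: "\<And>i. i < n \<Longrightarrow> e i \<in> DG_space \<Omega> \<T> r"
    and c: "\<And>K \<alpha>. K \<in> \<T> \<Longrightarrow> (\<Sum>i\<in>UNIV. \<alpha> i) \<le> r \<Longrightarrow> (\<Sum>i<n::nat. c i * coordinates r (e i) (K, \<alpha>)) = 0"
  shows "DG_form \<T> lam (\<lambda>x. \<Sum>i<n. c i * e i x) w = 0"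
proof (rule DG_form_zero, rule piece_zero_if_AE)
  fix K assume K: "K \<in> \<T>"
  have "AE x in lebesgue_on K. \<forall>i\<in>{..<n}. e i x = piece (e i) K x"
  proof (rule AE_finite_allI)
    fix i assume "i \<in> {..<n}"
    then have "e i \<in> DG_space \<Omega> \<T> r" using e by simp
    then show "AE x in lebesgue_on K. e i x = piece (e i) K x"
      using piece(2)[OF DG_space_piecewise_polynomial K] by blast
  qed simp
  then show "AE x in lebesgue_on K. (\<Sum>i<n. c i * e i x) = 0"
  proof eventually_elim
    case (elim x)
    let ?m = "\<lambda>\<alpha>. \<Prod>i\<in>UNIV. (x $ i) ^ \<alpha> i"
    have "(\<Sum>i<n. c i * e i x)
        = (\<Sum>i<n. \<Sum>\<alpha> | (\<Sum>i\<in>UNIV. \<alpha> i) \<le> r. c i * coordinates r (e i) (K, \<alpha>) * ?m \<alpha>)"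
    proof (rule sum.cong)
      fix i assume i: "i \<in> {..<n}"
      then have iN: "i < n" by simp
      have "e i x = piece (e i) K x" by (rule bspec[OF elim i])
      also have "\<dots> = (\<Sum>\<alpha> | (\<Sum>i\<in>UNIV. \<alpha> i) \<le> r. coordinates r (e i) (K, \<alpha>) * ?m \<alpha>)"
        by (rule piece_coordinates[OF e[OF iN] K])
      finally show "c i * e i x
          = (\<Sum>\<alpha> | (\<Sum>i\<in>UNIV. \<alpha> i) \<le> r. c i * coordinates r (e i) (K, \<alpha>) * ?m \<alpha>)"
        by (simp only: sum_distrib_left mult.assoc)
    qed simp
    also have "\<dots> = (\<Sum>\<alpha> | (\<Sum>i\<in>UNIV. \<alpha> i) \<le> r. (\<Sum>i<n. c i * coordinates r (e i) (K, \<alpha>)) * ?m \<alpha>)"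
      unfolding sum_distrib_right by (rule sum.swap)
    also have "\<dots> = 0"
      using c[OF K] by (intro sum.neutral) simp
    finally show ?case .
  qed
qed (assumption)

end

theorem theorem2p1:
  fixes \<Omega> :: "(real^'d) set"
    and \<TT> :: "(real^'d) set set set"
    and r :: nat
    and lam :: real
    and f fu fuu :: "real^'d \<Rightarrow> real \<Rightarrow> real"
    and u :: "real^'d \<Rightarrow> real"
  assumes dim: "CARD('d) = 2 \<or> CARD('d) = 3"
    and domain: "polyhedral_domain \<Omega>"
    and meshes: "\<And>\<T>. \<T> \<in> \<TT> \<Longrightarrow> conforming_mesh \<Omega> \<T>"
    and quasi_uniform: "quasi_uniform \<TT>"
    and degree_pos: "r \<ge> 1"
    and degree: "real r \<ge> real CARD('d) / 2"
    and f_measurable: "\<And>s. (\<lambda>x. f x s) \<in> borel_measurable (lebesgue_on \<Omega>)"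
    and f_deriv: "\<And>x s. x \<in> \<Omega> \<Longrightarrow> (f x has_real_derivative fu x s) (at s)"
    and fu_deriv: "\<And>x s. x \<in> \<Omega> \<Longrightarrow> (fu x has_real_derivative fuu x s) (at s)"
    and fuu_continuous: "\<And>x. x \<in> \<Omega> \<Longrightarrow> continuous_on UNIV (fuu x)"
    and fu_nonpos: "\<And>x s. x \<in> \<Omega> \<Longrightarrow> fu x s \<le> 0"
    and fu_bounded: "\<exists>M. \<forall>x\<in>\<Omega>. \<forall>s. \<bar>fu x s\<bar> \<le> M"
    and fuu_bounded: "\<exists>M. \<forall>x\<in>\<Omega>. \<forall>s. \<bar>fuu x s\<bar> \<le> M"
    and u_regular: "u \<in> sobolev_1_0 \<Omega> \<inter> sobolev (r + 1) \<Omega>"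
    and u_solution: "solves_semilinear \<Omega> f u"
    and lam_pos: "lam > 0"
    and lam_large: "\<And>\<T> vh. \<T> \<in> \<TT> \<Longrightarrow> vh \<in> DG_space \<Omega> \<T> r \<Longrightarrow>
          1 / 4 * (DG_norm \<T> lam vh)\<^sup>2 \<le> DG_form \<T> lam vh vh"
  shows "\<exists>h0>0. \<forall>\<T>\<in>\<TT>. mesh_size \<T> \<le> h0 \<longrightarrow>
           (\<exists>uh. solves_DG \<Omega> \<T> r lam f uh \<and>
              (\<forall>wh. solves_DG \<Omega> \<T> r lam f wh \<longrightarrow> (AE x in lebesgue_on \<Omega>. wh x = uh x)))"
proof -
  obtain M where M: "\<And>x s. x \<in> \<Omega> \<Longrightarrow> \<bar>fu x s\<bar> \<le> M" using fu_bounded by blast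
  have \<Omega>: "\<Omega> \<in> sets lebesgue" "\<Omega> \<noteq> {}"
    using domain by (auto simp: polyhedral_domain_def borel_open)
  \<comment> \<open>The bound \<open>M\<close> is known only at points of the domain, so its sign is
    read off at one of them.\<close>
  then obtain x0 where "x0 \<in> \<Omega>" by blast
  then have M0: "M \<ge> 0" using M[of x0 0] by simp
  have lip: "\<bar>f x s - f x t\<bar> \<le> M * \<bar>s - t\<bar>" if "x \<in> \<Omega>" for x s t
  proof -
    have "norm (f x s - f x t) \<le> M * norm (s - t)"
    proof (rule field_differentiable_bound)
      show "(f x has_field_derivative fu x z) (at z within UNIV)" for z
        using f_deriv[OF that] by simp
      show "norm (fu x z) \<le> M" for z using M[OF that] by simp
    qed auto
    then show ?thesis by simp
  qed
  have antimono: "f x t \<le> f x s" if "x \<in> \<Omega>" "s \<le> t" for x s t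
  proof (rule DERIV_nonpos_imp_nonincreasing[OF that(2)])
    show "\<exists>y. (f x has_real_derivative y) (at z) \<and> y \<le> 0" for z
      using f_deriv[OF that(1)] fu_nonpos[OF that(1)] by blast
  qed
  have uL2: "u \<in> L2 \<Omega>"
    using u_regular by (simp add: sobolev_def)
  obtain g where g0: "\<forall>i. g i \<in> L2 \<Omega> \<and> weak_partials \<Omega> [i, i] u (g i)"
    and g: "AE x in lebesgue_on \<Omega>. - (\<Sum>i\<in>UNIV. g i x) = f x (u x)"
    using u_solution unfolding solves_semilinear_def by (elim exE conjE)
  have fuL2: "(\<lambda>x. f x (u x)) \<in> L2 \<Omega>"
  proof (rule L2_cong_AE[OF _ _ g])
    have "(\<lambda>x. \<Sum>i\<in>UNIV. g i x) \<in> L2 \<Omega>" using g0 by (intro L2_sum) auto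
    then show "(\<lambda>x. - (\<Sum>i\<in>UNIV. g i x)) \<in> L2 \<Omega>"
      using L2_linear_combination[of _ \<Omega> "\<lambda>x. 0" "-1" 0] by (simp add: L2_zero)
    show "(\<lambda>x. f x (u x)) \<in> borel_measurable (lebesgue_on \<Omega>)"
    proof (rule borel_measurable_Caratheodory[OF f_measurable])
      show "continuous_on UNIV (f x)" if "x \<in> space (lebesgue_on \<Omega>)" for x
        using f_deriv that by (intro DERIV_continuous_on[of _ _ "fu x"]) (simp add: has_field_derivative_at_within)
      show "u \<in> borel_measurable (lebesgue_on \<Omega>)" using uL2 by (simp add: L2_def)
    qed
  qed
  interpret monotone_nonlinearity \<Omega> f M u
    by unfold_locales (use f_measurable antimono lip M0 uL2 fuL2 in auto)
  have "\<exists>uh. solves_DG \<Omega> \<T> r lam f uh \<and>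
      (\<forall>wh. solves_DG \<Omega> \<T> r lam f wh \<longrightarrow> (AE x in lebesgue_on \<Omega>. wh x = uh x))"
    if \<T>: "\<T> \<in> \<TT>" for \<T>
  proof -
    have mesh: "triangulation \<T>" "\<And>K. K \<in> \<T> \<Longrightarrow> int CARD('d) simplex K" "\<Union>\<T> = closure \<Omega>"
      using meshes[OF \<T>] by (auto simp: conforming_mesh_def)
    interpret simplicial_mesh \<T>
      by unfold_locales (use mesh dim in auto)
    let ?V = "DG_space \<Omega> \<T> r"
    let ?B = "DG_form \<T> lam"
    let ?F = "\<lambda>w v. LINT x|lebesgue_on \<Omega>. f x (w x) * v x"
    let ?J = "\<T> \<times> {\<alpha> :: 'd \<Rightarrow> nat. (\<Sum>i\<in>UNIV. \<alpha> i) \<le> r}"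
    note pp = DG_space_piecewise_polynomial
    have coercive: "1 / 4 * (DG_norm \<T> lam v)\<^sup>2 \<le> ?B v v" if "v \<in> ?V" for v
      using lam_large[OF \<T> that] .
    have nonneg: "?B v v \<ge> 0" if "v \<in> ?V" for v
      using coercive[OF that] zero_le_power2[of "DG_norm \<T> lam v"] by linarith
    \<comment> \<open>Stated with an inequality, since uniqueness delivers the form of a difference
      only as nonpositive.\<close>
    have kernel: "AE x in lebesgue_on \<Omega>. q x = 0" if q: "q \<in> ?V" "?B q q \<le> 0" for q
    proof (rule AE_domain[OF _ \<Omega>(1)])
      show "\<Omega> \<subseteq> \<Union>\<T>" using mesh(3) closure_subset by blast
      fix K assume K: "K \<in> \<T>"
      have "(DG_norm \<T> lam q)\<^sup>2 \<le> 0" using coercive[OF q(1)] q(2) by linarith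
      then have "DG_norm \<T> lam q = 0" by simp
      then have "piece q K = (\<lambda>x. 0)"
        using DG_norm_zero[OF pp[OF q(1)] lam_pos _ K] by blast
      then show "AE x in lebesgue_on K. q x = 0"
        using piece(2)[OF pp[OF q(1)] K] by simp
    qed
    \<comment> \<open>The right-hand side does not see changes of the test function by kernel
      elements, as these vanish almost everywhere.\<close>
    have F_kernel: "?F w q = 0" if "q \<in> ?V" "?B q q = 0" for w q
    proof -
      have "AE x in lebesgue_on \<Omega>. q x = 0" using kernel that by simp
      then have "AE x in lebesgue_on \<Omega>. f x (w x) * q x = 0" by eventually_elim simp
      then show ?thesis by (rule integral_eq_zero_AE)
    qed
    have diff: "(\<lambda>x. v x - w x) \<in> ?V" if "v \<in> ?V" "w \<in> ?V" for v w
      using DG_space_linear_combination[OF that, of 1 "-1"] by simp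
    have F_monotone: "?F v (\<lambda>x. v x - w x) - ?F w (\<lambda>x. v x - w x) \<le> 0" if "v \<in> ?V" "w \<in> ?V" for v w
      by (rule f_integral_monotone[OF DG_space_L2[OF that(1)] DG_space_L2[OF that(2)]
            DG_space_L2[OF diff[OF that]] refl])
    interpret finite_dim_form ?V ?B ?J "coordinates r"
    proof unfold_locales
      show "(\<lambda>x. 0) \<in> ?V" by (rule zero_in_DG_space)
      show "(\<lambda>x. a * v x + b * w x) \<in> ?V" if "v \<in> ?V" "w \<in> ?V" for v w a b
        using that by (rule DG_space_linear_combination)
      show "?B v w = ?B w v" for v w by (rule DG_form_commute)
      show "?B (\<lambda>x. a * v x + b * w x) z = a * ?B v z + b * ?B w z"
        if "v \<in> ?V" "w \<in> ?V" "z \<in> ?V" for v w z a b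
        using that by (intro DG_form_linear_combination pp)
      show "?B v v \<ge> 0" if "v \<in> ?V" for v using that by (rule nonneg)
      show "finite ?J" by (intro finite_cartesian_product finite_mesh finite_multi_indices)
      show "?B (\<lambda>x. \<Sum>i<n. c i * e i x) (\<lambda>x. \<Sum>i<n. c i * e i x) = 0"
        if "\<And>i. i < n \<Longrightarrow> e i \<in> ?V"
          "\<And>j. j \<in> ?J \<Longrightarrow> (\<Sum>i<n. c i * coordinates r (e i) j) = 0" for e c and n :: nat
        by (rule DG_form_zero_if_coordinates[OF that(1)], assumption) (use that(2) in auto)
    qed
    have "\<exists>uh\<in>?V. \<forall>v\<in>?V. ?B uh v = ?F uh v"
    proof (rule monotone_variational_equation)
      show "?F w (\<lambda>x. a * v x + b * z x) = a * ?F w v + b * ?F w z"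
        if "w \<in> ?V" "v \<in> ?V" "z \<in> ?V" for w v z a b
        using that by (intro f_integral_linear DG_space_L2)
      show "?F w q = 0" if "w \<in> ?V" "q \<in> ?V" "?B q q = 0" for w q
        using that by (intro F_kernel)
      show "?F v (\<lambda>x. v x - w x) - ?F w (\<lambda>x. v x - w x) \<le> 0" if "v \<in> ?V" "w \<in> ?V" for v w
        using that by (rule F_monotone)
      show "\<exists>C\<ge>0. \<forall>a b. \<bar>?F (\<lambda>z. \<Sum>i<n. a i * e i z) v - ?F (\<lambda>z. \<Sum>i<n. b i * e i z) v\<bar>
          \<le> C * (\<Sum>i<n. \<bar>a i - b i\<bar>)"
        if "\<And>i. i < n \<Longrightarrow> e i \<in> ?V" "v \<in> ?V" for e v and n :: nat
        by (rule f_integral_lipschitz[OF DG_space_L2[OF that(1)] DG_space_L2[OF that(2)]])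
    qed
    then obtain uh where uh: "uh \<in> ?V" "\<And>v. v \<in> ?V \<Longrightarrow> ?B uh v = ?F uh v" by blast
    have "AE x in lebesgue_on \<Omega>. wh x = uh x" if "solves_DG \<Omega> \<T> r lam f wh" for wh
    proof -
      have wh: "wh \<in> ?V" "\<And>v. v \<in> ?V \<Longrightarrow> ?B wh v = ?F wh v"
        using that by (auto simp: solves_DG_def)
      let ?d = "\<lambda>x. uh x - wh x"
      have dV: "?d \<in> ?V" by (rule diff[OF uh(1) wh(1)])
      have "?B ?d ?d = ?B uh ?d - ?B wh ?d"
        using form_linear[OF uh(1) wh(1) dV, of 1 "-1"] by simp
      also have "\<dots> = ?F uh ?d - ?F wh ?d" by (simp only: uh(2)[OF dV] wh(2)[OF dV])
      also have "\<dots> \<le> 0" by (rule F_monotone[OF uh(1) wh(1)])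
      finally have "AE x in lebesgue_on \<Omega>. ?d x = 0" by (rule kernel[OF dV])
      then show ?thesis by eventually_elim simp
    qed
    moreover have "solves_DG \<Omega> \<T> r lam f uh" using uh by (simp add: solves_DG_def)
    ultimately show ?thesis by blast
  qed
  then show ?thesis by (intro exI[of _ 1]) auto
qed

end
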